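(* Let $d\ge 1$ be an integer and let $T_j:H(\mathbb{C}^d)\rightarrow H(\mathbb{C}^d)$, $j=1,\dots,d$, be continuous linear operators such that 1. $\bigcap_{j=1}^d\ker T_j\neq\{0\}$; 2. there are constants $a_1,\dots,a_d\in\mathbb{C}\setminus\{0\}$ such that $$\Bigl[T_j,\frac{\partial}{\partial z_k}\Bigr]=\delta_{jk}a_jI,\qquad j,k=1,\dots,d,$$ where $\delta_{jk}$ is Kronecker's delta and $I$ is the identity operator on $H(\mathbb{C}^d)$. Let $f\in\bigcap_{j=1}^d\ker T_j$, $f\not\equiv 0$. Then the system $\{D^nf,\ n\in\mathbb{N}_0^d\}$ is complete in $H(\mathbb{C}^d)$.
   Context: $H(\mathbb{C}^d)$ is the space of all entire functions on $\mathbb{C}^d$ (variables $z=(z_1,\dots,z_d)$) with the topology of uniform convergence on compact subsets. For linear operators $A,B$ on $H(\mathbb{C}^d)$, $[A,B]=AB-BA$ is the commutator. $\mathbb{N}_0$ is the set of non-negative integers; for $n=(n_1,\dots,n_d)\in\mathbb{N}_0^d$, $\|n\|=n_1+\cdots+n_d$ and $D^n=\frac{\partial^{\|n\|}}{\partial z_1^{n_1}\cdots\partial z_d^{n_d}}$. A system of elements of a topological vector space $X$ is complete in $X$ if its linear span is dense in $X$. *)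

theory Defs
  imports "HOL-Analysis.Analysis" "HOL-Library.Function_Algebras"
begin

text \<open>
  The space of entire functions on complex \<open>d\<close>-space, \<open>d = CARD('d)\<close>, is the carrier set
  \<open>entire\<close> in the type \<open>complex ^ 'd \<Rightarrow> complex\<close>. Sums, differences and \<open>0\<close> of functions are the
  pointwise ones of \<open>HOL-Library.Function_Algebras\<close>. An operator is a function on the whole type of
  which only the values on \<open>entire\<close> matter.
\<close>

definition entire :: "(complex ^ 'd \<Rightarrow> complex) set" where
  "entire = {f. \<forall>z. \<exists>D. Vector_Spaces.linear (*s) (*) D \<and> (f has_derivative D) (at z)}"

definition fscale :: "complex \<Rightarrow> ('a \<Rightarrow> complex) \<Rightarrow> 'a \<Rightarrow> complex" where
  "fscale c f = (\<lambda>z. c * f z)"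

global_interpretation fspace: vector_space fscale
  by unfold_locales (auto simp: fscale_def algebra_simps fun_eq_iff)

text \<open>The topology of uniform convergence on compact sets.\<close>

definition compact_nhd ::
    "(complex ^ 'd) set \<Rightarrow> real \<Rightarrow> (complex ^ 'd \<Rightarrow> complex) \<Rightarrow> (complex ^ 'd \<Rightarrow> complex) set" where
  "compact_nhd K e f = {g \<in> entire. \<forall>z\<in>K. dist (g z) (f z) < e}"

definition entire_top :: "(complex ^ 'd \<Rightarrow> complex) topology" where
  "entire_top = topology (\<lambda>U. U \<subseteq> entire \<and>
     (\<forall>f\<in>U. \<exists>K e. compact K \<and> 0 < e \<and> compact_nhd K e f \<subseteq> U))"

lemma openin_entire_top:
  "openin entire_top U \<longleftrightarrow> U \<subseteq> entire \<and>
     (\<forall>f\<in>U. \<exists>K e. compact K \<and> 0 < e \<and> compact_nhd K e f \<subseteq> U)"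
proof -
  let ?P = "\<lambda>U :: (complex ^ 'd \<Rightarrow> complex) set. U \<subseteq> entire \<and>
     (\<forall>f\<in>U. \<exists>K e. compact K \<and> 0 < e \<and> compact_nhd K e f \<subseteq> U)"
  have Int: "?P (U \<inter> V)" if U: "?P U" and V: "?P V" for U V
  proof (intro conjI ballI)
    show "U \<inter> V \<subseteq> entire" using U by blast
    fix f assume f: "f \<in> U \<inter> V"
    obtain K e where 1: "compact K" "0 < e" "compact_nhd K e f \<subseteq> U" using U f by blast
    obtain L e' where 2: "compact L" "0 < e'" "compact_nhd L e' f \<subseteq> V" using V f by blast
    have "compact_nhd (K \<union> L) (min e e') f \<subseteq> compact_nhd K e f \<inter> compact_nhd L e' f"
      unfolding compact_nhd_def by auto
    then have "compact_nhd (K \<union> L) (min e e') f \<subseteq> U \<inter> V" using 1 2 by blast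
    moreover have "compact (K \<union> L)" "0 < min e e'" using 1 2 by (auto intro: compact_Un)
    ultimately show "\<exists>K e. compact K \<and> 0 < e \<and> compact_nhd K e f \<subseteq> U \<inter> V" by blast
  qed
  have Un: "?P (\<Union>\<U>)" if *: "\<And>U. U \<in> \<U> \<Longrightarrow> ?P U" for \<U>
  proof (intro conjI ballI)
    show "\<Union>\<U> \<subseteq> entire" using * by blast
    fix f assume "f \<in> \<Union>\<U>"
    then obtain U where "U \<in> \<U>" "f \<in> U" by blast
    with *[of U] obtain K e where "compact K" "0 < e" "compact_nhd K e f \<subseteq> U" by blast
    with \<open>U \<in> \<U>\<close> show "\<exists>K e. compact K \<and> 0 < e \<and> compact_nhd K e f \<subseteq> \<Union>\<U>"
      by (meson Union_upper order_trans)
  qed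
  have "istopology ?P"
    unfolding istopology_def
  proof (rule conjI; intro allI impI)
    show "?P (U \<inter> V)" if "?P U" "?P V" for U V using Int[OF that] .
    show "?P (\<Union>\<U>)" if "\<forall>U\<in>\<U>. ?P U" for \<U> by (rule Un) (rule bspec[OF that])
  qed
  from topology_inverse'[OF this] show ?thesis unfolding entire_top_def by (rule fun_cong)
qed

lemma topspace_entire_top [simp]: "topspace entire_top = entire"
proof -
  have "openin entire_top (entire :: (complex ^ 'd \<Rightarrow> complex) set)"
    unfolding openin_entire_top compact_nhd_def
    by (auto intro!: exI[of _ "{}"] exI[of _ "1::real"])
  then show ?thesis
    by (metis openin_entire_top openin_subset openin_topspace subset_antisym)
qed

text \<open>Continuous linear operators; \<open>continuous_map\<close> includes that \<open>entire\<close> is mapped to itself.\<close>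

definition cont_lin_operator ::
    "((complex ^ 'd \<Rightarrow> complex) \<Rightarrow> (complex ^ 'd \<Rightarrow> complex)) \<Rightarrow> bool" where
  "cont_lin_operator T \<longleftrightarrow> continuous_map entire_top entire_top T \<and>
     (\<forall>f\<in>entire. \<forall>g\<in>entire. T (f + g) = T f + T g) \<and>
     (\<forall>c. \<forall>f\<in>entire. T (fscale c f) = fscale c (T f))"

definition ker :: "((complex ^ 'd \<Rightarrow> complex) \<Rightarrow> (complex ^ 'd \<Rightarrow> complex)) \<Rightarrow>
    (complex ^ 'd \<Rightarrow> complex) set" where
  "ker T = {f \<in> entire. T f = 0}"

definition commutator :: "('a \<Rightarrow> 'a) \<Rightarrow> ('a \<Rightarrow> 'a) \<Rightarrow> 'a \<Rightarrow> ('a :: minus)" where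
  "commutator A B f = A (B f) - B (A f)"

definition partial :: "'d \<Rightarrow> (complex ^ 'd \<Rightarrow> complex) \<Rightarrow> complex ^ 'd \<Rightarrow> complex" where
  "partial k f z = deriv (\<lambda>w. f (z + axis k w)) 0"

text \<open>
  The order on the index type only fixes the order of differentiation, the partial derivative with
  respect to the largest index being applied first.
\<close>

definition mixed_partial :: "('d \<Rightarrow> nat) \<Rightarrow>
    (complex ^ 'd::{finite,linorder} \<Rightarrow> complex) \<Rightarrow> complex ^ 'd::{finite,linorder} \<Rightarrow> complex" where
  "mixed_partial n f = foldr (\<lambda>k. partial k ^^ n k) (sorted_list_of_set UNIV) f"

definition complete_system :: "(complex ^ 'd \<Rightarrow> complex) set \<Rightarrow> bool" where
  "complete_system S \<longleftrightarrow> S \<subseteq> entire \<and> entire_top closure_of (fspace.span S) = entire"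

end

(* Let V be the closed span of the derivatives D^n f. It is invariant under every d/dz_k and, by the
   commutation relations and T_j f = 0, under every T_j. The operator L_j = T_j + a_j z_j commutes
   with all d/dz_k, hence with translations, so L_j g (w) = L_j (g(. + w)) (0); expanding g(v + w) in a
   Taylor series in v shows that L_j g lies in V whenever g does. Hence V is also invariant under
   multiplication by z_j = (L_j - T_j) / a_j. Now the Taylor series of g at z, evaluated at the
   increment -z, expresses the constant g(0) by the products of polynomials in z and derivatives of
   g. So V contains g(0) for every g in V; not all of these constants vanish because f is not 0.
   Thus V contains 1, all polynomials, and by density all entire functions. *)

theory Submission
  imports Defs "HOL-Complex_Analysis.Cauchy_Integral_Formula"
begin

section \<open>Directional derivatives of entire functions\<close>

text \<open>The operators \<open>T j\<close> are known only through their commutators, so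
  multiplication by a coordinate has to be recovered. Since [z_j, d/dz_k] = -delta_jk, adding
  \<open>a j\<close> times that multiplication cancels the commutator and leaves a convolution: g is
  sent to w |-> mu(g(. + w)) with the continuous functional mu(h) = L h 0. The obstacle is that mu
  acts on functions of the increment, while membership in V concerns the base point. Taylor
  polynomials separate the two variables: they are finite sums of products p(v) g(w) with p a
  polynomial and g in V. The same finite sums serve when mu is applied in v and when v = -w is
  substituted, which is where multiplication by polynomials enters. The analysis is reduced to one
  complex variable by restriction to lines t |-> g(w + t v), so that Cauchy's inequality there
  replaces a Cauchy integral in several variables. That partial derivatives are again entire then
  comes from uniform limits of difference quotients.\<close>

lemma norm_scalar_mult_vec: "norm (c *s v) = norm c * norm (v :: complex ^ 'd)"
  by (simp add: norm_vec_def vector_scalar_mult_def norm_mult L2_set_right_distrib)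

text \<open>Cauchy's inequality on the circle of radius 2 bounds the m-th term by B (|t|/2)^m. For
  |t| \<le> 1 the ratio is at most 1/2, so the geometric tail costs at most a factor 2. The case N =
  2 controls difference quotients, the case t = 1 gives Taylor expansion along lines.\<close>

lemma taylor_remainder_bound:
  fixes \<phi> :: "complex \<Rightarrow> complex"
  assumes hol: "\<phi> holomorphic_on UNIV"
    and B: "\<And>t. norm t = 2 \<Longrightarrow> norm (\<phi> t) \<le> B"
    and t: "norm t \<le> 1"
  shows "norm (\<phi> t - (\<Sum>m<N. (deriv ^^ m) \<phi> 0 / fact m * t ^ m)) \<le> 2 * B * (norm t / 2) ^ N"
proof -
  let ?c = "\<lambda>m. (deriv ^^ m) \<phi> 0 / fact m * t ^ m"
  have sums: "?c sums \<phi> t"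
    using holomorphic_power_series[of \<phi> 0 "norm t + 1" t] holomorphic_on_subset[OF hol]
    by simp
  have c: "norm (?c m) \<le> B * (norm t / 2) ^ m" for m
  proof -
    have "norm ((deriv ^^ m) \<phi> 0) \<le> fact m * B / 2 ^ m"
      using hol by (intro Cauchy_inequality)
        (auto intro: holomorphic_on_subset continuous_on_subset holomorphic_on_imp_continuous_on B)
    then have "norm ((deriv ^^ m) \<phi> 0) / fact m * norm t ^ m \<le> B / 2 ^ m * norm t ^ m"
      by (intro mult_right_mono) (auto simp: field_simps)
    then show ?thesis
      by (simp add: norm_mult norm_divide norm_power power_divide)
  qed
  have B0: "B \<ge> 0" using order_trans[OF norm_ge_zero c[of 0]] by simp
  let ?q = "norm t / 2"
  have g: "(\<lambda>m. B * ?q ^ (m + N)) sums (B * ?q ^ N * (1 / (1 - ?q)))"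
    using sums_mult[OF geometric_sums[of ?q], of "B * ?q ^ N"] t
    by (simp add: power_add mult_ac)
  have "(\<lambda>m. ?c (m + N)) sums (\<phi> t - (\<Sum>m<N. ?c m))"
    using sums sums_iff_shift[of ?c N "\<phi> t - (\<Sum>m<N. ?c m)"] by auto
  then have "norm (\<phi> t - (\<Sum>m<N. ?c m)) \<le> B * ?q ^ N * (1 / (1 - ?q))"
    using norm_suminf_le[of "\<lambda>m. ?c (m + N)" "\<lambda>m. B * ?q ^ (m + N)"] c g
    by (simp add: sums_iff)
  also have "\<dots> \<le> B * ?q ^ N * 2"
    using t B0 by (intro mult_left_mono) (auto simp: field_simps)
  finally show ?thesis by (simp add: mult_ac)
qed

text \<open>Written through partial derivatives and without normalising v, so that the m-th iterate
  is visibly a homogeneous polynomial of degree m in v whose coefficients are partial derivatives of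
  g.\<close>

definition dird :: "complex ^ 'd \<Rightarrow> (complex ^ 'd \<Rightarrow> complex) \<Rightarrow> complex ^ 'd \<Rightarrow> complex" where
  "dird v g = (\<lambda>z. \<Sum>k\<in>UNIV. v $ k * partial k g z)"

lemma axis_eq_scalar_mult: "axis k w = w *s axis k (1::complex)"
  by (auto simp: axis_def vec_eq_iff)

lemma has_derivative_line:
  "((\<lambda>t. z + t *s v) has_derivative (\<lambda>t. t *s v)) (at (t::complex))" for v :: "complex ^ 'd"
proof -
  have "bounded_linear (\<lambda>t. t *s v)"
    by (rule bounded_linear_intro[where K="norm v"])
      (auto simp: vec_eq_iff algebra_simps norm_scalar_mult_vec)
  then show ?thesis
    by (auto intro!: derivative_eq_intros bounded_linear_imp_has_derivative)
qed

lemma entire_has_derivative: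
  assumes "g \<in> entire"
  shows "(g has_derivative (\<lambda>v. dird v g z)) (at z)"
proof -
  obtain D where D: "Vector_Spaces.linear (*s) (*) D" "(g has_derivative D) (at z)"
    using assms unfolding entire_def by blast
  interpret D: Vector_Spaces.linear "(*s)" "(*)" D by fact
  have p: "partial k g z = D (axis k 1)" for k
  proof -
    have "((\<lambda>t. g (z + t *s axis k 1)) has_derivative (\<lambda>t. D (t *s axis k 1))) (at 0)"
      using D(2) by (intro has_derivative_compose[OF has_derivative_line]) simp
    also have "(\<lambda>t. D (t *s axis k 1)) = (*) (D (axis k 1))"
      by (auto simp: D.scale)
    finally have "((\<lambda>t. g (z + axis k t)) has_field_derivative D (axis k 1)) (at 0)"
      unfolding has_field_derivative_def by (simp flip: axis_eq_scalar_mult)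
    then show ?thesis unfolding partial_def by (rule DERIV_imp_deriv)
  qed
  have "D v = dird v g z" for v
  proof -
    have "D v = D (\<Sum>k\<in>UNIV. v $ k *s axis k 1)" by (simp add: basis_expansion)
    then show ?thesis by (simp add: D.sum D.scale dird_def p)
  qed
  then have "D = (\<lambda>v. dird v g z)" by auto
  with D(2) show ?thesis by simp
qed

text \<open>Restriction to complex lines is how the one-variable theory enters. The derivative is
  given at every t, not only at 0, so that it can be iterated.\<close>

lemma entire_has_field_derivative_line:
  assumes "g \<in> entire"
  shows "((\<lambda>t. g (z + t *s v)) has_field_derivative dird v g (z + t *s v)) (at t)"
proof -
  have "((\<lambda>t. g (z + t *s v)) has_derivative (\<lambda>s. dird (s *s v) g (z + t *s v))) (at t)"
    by (intro has_derivative_compose[OF has_derivative_line] entire_has_derivative assms)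
  also have "(\<lambda>s. dird (s *s v) g (z + t *s v)) = (*) (dird v g (z + t *s v))"
    by (auto simp: dird_def mult_ac sum_distrib_left)
  finally show ?thesis unfolding has_field_derivative_def .
qed

lemma entire_holomorphic_line:
  assumes "g \<in> entire"
  shows "(\<lambda>t. g (z + t *s v)) holomorphic_on A"
  unfolding holomorphic_on_def field_differentiable_def
  using has_field_derivative_at_within[OF entire_has_field_derivative_line[OF assms]] by fast

lemma linear_coordinate_sum: "Vector_Spaces.linear (*s) (*) (\<lambda>v. \<Sum>k\<in>UNIV. v $ k * p k)"
  for p :: "'d::finite \<Rightarrow> complex"
proof unfold_locales
  show "(\<Sum>k\<in>UNIV. (v + w) $ k * p k) = (\<Sum>k\<in>UNIV. v $ k * p k) + (\<Sum>k\<in>UNIV. w $ k * p k)" for v w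
    unfolding vector_add_component distrib_right sum.distrib ..
  show "(\<Sum>k\<in>UNIV. (c *s v) $ k * p k) = c * (\<Sum>k\<in>UNIV. v $ k * p k)" for c v
    unfolding sum_distrib_left vector_smult_component mult.assoc ..
qed

text \<open>The coordinate form of the derivative makes it complex linear at once. One such formula
  gives membership here and the partial derivatives through \<open>partial_eqI\<close>; the closure
  properties below use the two together.\<close>

lemma entireI:
  assumes "\<And>z. (g has_derivative (\<lambda>v. \<Sum>k\<in>UNIV. v $ k * p k z)) (at z)"
  shows "g \<in> entire"
  unfolding entire_def
proof (intro CollectI allI exI conjI)
  show "(g has_derivative (\<lambda>v. \<Sum>k\<in>UNIV. v $ k * p k z)) (at z)" for z by fact
qed (rule linear_coordinate_sum)

lemma partial_eqI:
  fixes g :: "complex ^ 'd \<Rightarrow> complex"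
  assumes "(g has_derivative (\<lambda>v. \<Sum>k\<in>UNIV. v $ k * p k)) (at z)"
  shows "partial k g z = p k"
proof -
  have "((\<lambda>t. g (z + t *s axis k 1)) has_derivative
      (\<lambda>t. \<Sum>i\<in>UNIV. (t *s axis k 1) $ i * p i)) (at 0)"
    using assms by (intro has_derivative_compose[OF has_derivative_line]) simp
  also have "(\<lambda>t. \<Sum>i\<in>UNIV. (t *s axis k 1) $ i * p i) = (\<lambda>t. p k * t)"
    by (auto simp: axis_def if_distrib if_distribR cong: if_cong)
  finally show ?thesis
    unfolding partial_def has_field_derivative_def[symmetric]
    by (intro DERIV_imp_deriv) (simp flip: axis_eq_scalar_mult)
qed

section \<open>Sums, multiples, coordinate multiplication and translates of entire functions\<close>

lemma entire_add:
  assumes "f \<in> entire" "g \<in> entire"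
  shows "f + g \<in> entire" "partial k (f + g) = partial k f + partial k g"
proof -
  have *: "(f + g has_derivative (\<lambda>v. \<Sum>k\<in>UNIV. v $ k * (partial k f z + partial k g z))) (at z)" for z
  proof -
    have "((\<lambda>z. f z + g z) has_derivative (\<lambda>v. dird v f z + dird v g z)) (at z)"
      by (intro has_derivative_add entire_has_derivative assms)
    also have "(\<lambda>v. dird v f z + dird v g z) =
        (\<lambda>v. \<Sum>k\<in>UNIV. v $ k * (partial k f z + partial k g z))"
      by (simp add: dird_def distrib_left sum.distrib)
    finally show ?thesis unfolding plus_fun_def .
  qed
  show "f + g \<in> entire" by (rule entireI) (rule *)
  show "partial k (f + g) = partial k f + partial k g"
    by (rule ext) (simp add: partial_eqI[OF *])
qed

lemma entire_fscale:
  assumes "f \<in> entire"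
  shows "fscale c f \<in> entire" "partial k (fscale c f) = fscale c (partial k f)"
proof -
  have *: "(fscale c f has_derivative (\<lambda>v. \<Sum>k\<in>UNIV. v $ k * (c * partial k f z))) (at z)" for z
  proof -
    have "((\<lambda>z. c * f z) has_derivative (\<lambda>v. c * dird v f z)) (at z)"
      by (intro has_derivative_mult_right entire_has_derivative assms)
    also have "(\<lambda>v. c * dird v f z) = (\<lambda>v. \<Sum>k\<in>UNIV. v $ k * (c * partial k f z))"
      by (simp add: dird_def sum_distrib_left mult.left_commute)
    finally show ?thesis unfolding fscale_def .
  qed
  show "fscale c f \<in> entire" by (rule entireI) (rule *)
  show "partial k (fscale c f) = fscale c (partial k f)"
    using partial_eqI[OF *] by (simp add: fun_eq_iff) (simp add: fscale_def)
qed

lemma entire_const: "(\<lambda>_. c) \<in> entire"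
  by (rule entireI[where p="\<lambda>_ _. 0"]) simp

lemma entire_coord:
  assumes "f \<in> entire"
  shows "(\<lambda>z. z $ j * f z) \<in> entire"
    and "partial k (\<lambda>z. z $ j * f z) = (\<lambda>z. z $ j * partial k f z + (if j = k then f z else 0))"
proof -
  have *: "((\<lambda>z. z $ j * f z) has_derivative
      (\<lambda>v. \<Sum>k\<in>UNIV. v $ k * (z $ j * partial k f z + (if j = k then f z else 0)))) (at z)" for z
  proof -
    have "((\<lambda>z. z $ j * f z) has_derivative (\<lambda>v. z $ j * dird v f z + v $ j * f z)) (at z)"
      by (intro has_derivative_mult entire_has_derivative assms
          bounded_linear_imp_has_derivative bounded_linear_vec_nth)
    also have "(\<lambda>v. z $ j * dird v f z + v $ j * f z) =
      (\<lambda>v. \<Sum>k\<in>UNIV. v $ k * (z $ j * partial k f z + (if j = k then f z else 0)))"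
      by (simp add: dird_def distrib_left sum.distrib sum_distrib_left mult.left_commute
          if_distrib[of "\<lambda>x. _ * x"] cong: if_cong)
    finally show ?thesis .
  qed
  show "(\<lambda>z. z $ j * f z) \<in> entire" by (rule entireI) (rule *)
  show "partial k (\<lambda>z. z $ j * f z) = (\<lambda>z. z $ j * partial k f z + (if j = k then f z else 0))"
    by (rule ext) (simp add: partial_eqI[OF *])
qed

lemma entire_subspace: "fspace.subspace entire"
  unfolding fspace.subspace_def using entire_add entire_fscale entire_const[of 0]
  by (auto simp: zero_fun_def)

lemma entire_continuous_on: "f \<in> entire \<Longrightarrow> continuous_on A f"
  by (meson entire_has_derivative has_derivative_continuous continuous_at_imp_continuous_on)

lemma entire_translate:
  assumes "f \<in> entire"
  shows "(\<lambda>z. f (z + u)) \<in> entire" "partial k (\<lambda>z. f (z + u)) = (\<lambda>z. partial k f (z + u))"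
proof -
  have *: "((\<lambda>z. f (z + u)) has_derivative (\<lambda>v. \<Sum>k\<in>UNIV. v $ k * partial k f (z + u))) (at z)" for z
  proof -
    have "((\<lambda>z. z + u) has_derivative (\<lambda>v. v)) (at z)" by (auto intro!: derivative_eq_intros)
    from has_derivative_compose[OF this entire_has_derivative[OF assms]]
    show ?thesis unfolding dird_def .
  qed
  show "(\<lambda>z. f (z + u)) \<in> entire" by (rule entireI) (rule *)
  show "partial k (\<lambda>z. f (z + u)) = (\<lambda>z. partial k f (z + u))"
    by (rule ext) (simp add: partial_eqI[OF *])
qed

lemma entire_sum:
  "(\<And>i. i \<in> I \<Longrightarrow> g i \<in> entire) \<Longrightarrow> (\<Sum>i\<in>I. g i) \<in> entire"
  by (rule fspace.subspace_sum[OF entire_subspace])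

lemma sum_fun_apply: "(\<Sum>i\<in>I. g i) x = (\<Sum>i\<in>I. g i x)"
  by (induction I rule: infinite_finite_induct) auto

lemma dird_eq_sum: "dird v g = (\<Sum>k\<in>UNIV. fscale (v $ k) (partial k g))"
  by (simp add: dird_def fscale_def sum_fun_apply fun_eq_iff)

lemma entire_diff:
  assumes "f \<in> entire" "g \<in> entire"
  shows "f - g \<in> entire" "partial k (f - g) = partial k f - partial k g"
proof -
  have eq: "f - g = f + fscale (-1) g" by (auto simp: fscale_def)
  show "f - g \<in> entire" unfolding eq by (intro entire_add entire_fscale assms)
  show "partial k (f - g) = partial k f - partial k g"
    unfolding eq entire_add(2)[OF assms(1) entire_fscale(1)[OF assms(2)]] entire_fscale(2)[OF assms(2)]
    by (auto simp: fscale_def)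
qed

section \<open>Uniform limits, partial derivatives and Taylor expansion\<close>

lemma entire_bounded:
  assumes "g \<in> entire"
  obtains B where "\<And>z. norm z \<le> R \<Longrightarrow> norm (g z) \<le> B"
proof -
  have "bounded (g ` cball 0 R)"
    by (intro compact_imp_bounded compact_continuous_image entire_continuous_on assms compact_cball)
  then obtain B where "\<forall>z\<in>cball 0 R. norm (g z) \<le> B" by (auto simp: bounded_iff)
  then show ?thesis by (intro that) auto
qed

lemma norm_axis: "norm (axis k x) = norm (x :: complex)"
  by (simp add: norm_eq_sqrt_inner inner_axis_axis)

text \<open>Cauchy's inequality on the unit circle in direction k. Enlarging the radius by 1 is the
  price for controlling a derivative by the function itself; this also yields continuity of
  \<open>partial k\<close>.\<close>

lemma norm_partial_le:
  assumes g: "g \<in> entire" and B: "\<And>w. norm w \<le> norm z + 1 \<Longrightarrow> norm (g w) \<le> B"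
  shows "norm (partial k g z) \<le> B"
proof -
  let ?\<phi> = "\<lambda>t. g (z + t *s axis k 1)"
  have "norm ((deriv ^^ 1) ?\<phi> 0) \<le> fact 1 * B / 1 ^ 1"
  proof (rule Cauchy_inequality)
    show "continuous_on (cball 0 1) ?\<phi>"
      by (intro holomorphic_on_imp_continuous_on entire_holomorphic_line g)
    fix t :: complex assume "norm (0 - t) = 1"
    then have "norm (z + t *s axis k 1) \<le> norm z + 1"
      using norm_triangle_ineq[of z "t *s axis k 1"] by (simp add: norm_scalar_mult_vec norm_axis)
    then show "norm (?\<phi> t) \<le> B" by (rule B)
  qed (auto intro: entire_holomorphic_line g)
  then show ?thesis by (simp add: partial_def flip: axis_eq_scalar_mult)
qed

text \<open>Weierstrass' theorem: by the Cauchy estimate the partial derivatives are uniformly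
  Cauchy on balls, and a sequence whose derivatives converge uniformly may be differentiated in the
  limit.\<close>

lemma entire_uniform_limit:
  fixes F :: "nat \<Rightarrow> complex ^ 'd \<Rightarrow> complex"
  assumes F: "\<And>n. F n \<in> entire"
    and lim: "\<And>R e. e > 0 \<Longrightarrow> \<exists>N. \<forall>n\<ge>N. \<forall>z. norm z \<le> R \<longrightarrow> norm (F n z - G z) < e"
  shows "G \<in> entire"
proof -
  have Cauchy: "\<exists>N. \<forall>m\<ge>N. \<forall>n\<ge>N. \<forall>z k. norm z \<le> R \<longrightarrow>
      norm (partial k (F m) z - partial k (F n) z) \<le> e" if e: "e > 0" for R e
  proof -
    obtain N where N: "\<And>n z. n \<ge> N \<Longrightarrow> norm z \<le> R + 1 \<Longrightarrow> norm (F n z - G z) < e / 2"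
      using lim[of "e / 2" "R + 1"] e by auto
    have "norm (partial k (F m) z - partial k (F n) z) \<le> e"
      if "m \<ge> N" "n \<ge> N" "norm z \<le> R" for m n z k
    proof -
      have "norm ((F m - F n) w) \<le> e" if "norm w \<le> norm z + 1" for w
        using norm_diff_triangle_less[of "F m w" "G w" "e/2" "F n w" "e/2"] N[of m w] N[of n w] \<open>m \<ge> N\<close> \<open>n \<ge> N\<close>
          that \<open>norm z \<le> R\<close> by (auto simp: norm_minus_commute)
      from norm_partial_le[OF entire_diff(1)[OF F F] this]
      have "norm (partial k (F m - F n) z) \<le> e" .
      then show ?thesis by (simp add: entire_diff(2)[OF F F])
    qed
    then show ?thesis by blast
  qed
  define P where "P k z = lim (\<lambda>n. partial k (F n) z)" for k z
  have P: "(\<lambda>n. partial k (F n) z) \<longlonglongrightarrow> P k z" for k z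
  proof -
    have "Cauchy (\<lambda>n. partial k (F n) z)"
    proof (rule CauchyI)
      fix e :: real assume "e > 0"
      then obtain N where "\<forall>m\<ge>N. \<forall>n\<ge>N. norm (partial k (F m) z - partial k (F n) z) \<le> e / 2"
        using Cauchy[OF half_gt_zero[OF \<open>e > 0\<close>], of "norm z"] by blast
      with \<open>e > 0\<close> show "\<exists>N. \<forall>m\<ge>N. \<forall>n\<ge>N. norm (partial k (F m) z - partial k (F n) z) < e"
        by (smt (verit) field_sum_of_halves)
    qed
    then show ?thesis
      unfolding P_def by (simp add: Cauchy_convergent convergent_LIMSEQ_iff[symmetric])
  qed
  have "(G has_derivative (\<lambda>v. \<Sum>k\<in>UNIV. v $ k * P k x)) (at x)" for x
  proof -
    \<comment> \<open>A convex open neighbourhood of x that is bounded, as uniform convergence is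
      available only on bounded sets.\<close>
    define S :: "(complex ^ 'd) set" where "S = ball 0 (norm x + 1)"
    have x: "x \<in> S" "open S" "convex S" by (auto simp: S_def)
    have G: "(\<lambda>n. F n z) \<longlonglongrightarrow> G z" for z
      using lim[of _ "norm z"] by (fastforce simp: LIMSEQ_iff)
    have unif: "\<forall>\<^sub>F n in sequentially. \<forall>z\<in>S. \<forall>v.
        norm (dird v (F n) z - (\<Sum>k\<in>UNIV. v $ k * P k z)) \<le> e * norm v" if e: "e > 0" for e
    proof -
      \<comment> \<open>Each of the CARD('d) coordinates contributes at most
        \<open>norm v * c\<close> to the error of the directional derivative.\<close>
      define c where "c = e / CARD('d)"
      have c: "c > 0" using e by (simp add: c_def)
      obtain N where N: "\<And>m n z k. m \<ge> N \<Longrightarrow> n \<ge> N \<Longrightarrow> norm z \<le> norm x + 1 \<Longrightarrow>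
          norm (partial k (F m) z - partial k (F n) z) \<le> c"
        using Cauchy[OF c, of "norm x + 1"] by blast
      have "norm (dird v (F n) z - (\<Sum>k\<in>UNIV. v $ k * P k z)) \<le> e * norm v"
        if "n \<ge> N" "z \<in> S" for n z v
      proof -
        have *: "norm (partial k (F n) z - P k z) \<le> c" for k
        proof (rule Lim_bounded)
          show "(\<lambda>m. norm (partial k (F n) z - partial k (F m) z)) \<longlonglongrightarrow> norm (partial k (F n) z - P k z)"
            by (intro tendsto_intros P)
          show "\<forall>m\<ge>N. norm (partial k (F n) z - partial k (F m) z) \<le> c"
            using N that by (auto simp: S_def)
        qed
        have "norm (dird v (F n) z - (\<Sum>k\<in>UNIV. v $ k * P k z)) =
            norm (\<Sum>k\<in>UNIV. v $ k * (partial k (F n) z - P k z))"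
          by (simp add: dird_def sum_subtractf right_diff_distrib)
        also have "\<dots> \<le> (\<Sum>k\<in>(UNIV::'d set). norm v * c)"
        proof (rule sum_norm_le)
          fix k
          show "norm (v $ k * (partial k (F n) z - P k z)) \<le> norm v * c"
            unfolding norm_mult by (intro mult_mono * Finite_Cartesian_Product.norm_nth_le) auto
        qed
        also have "\<dots> = e * norm v" by (simp add: c_def)
        finally show ?thesis .
      qed
      then show ?thesis unfolding eventually_sequentially by blast
    qed
    have "\<exists>g. \<forall>z\<in>S. (\<lambda>n. F n z) \<longlonglongrightarrow> g z \<and>
        (g has_derivative (\<lambda>v. \<Sum>k\<in>UNIV. v $ k * P k z)) (at z within S)"
    proof (rule has_derivative_sequence)
      show "(F n has_derivative (\<lambda>v. dird v (F n) z)) (at z within S)" for n z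
        by (rule has_derivative_at_withinI[OF entire_has_derivative[OF F]])
    qed (fact x G unif)+
    then obtain g where g: "\<And>z. z \<in> S \<Longrightarrow> (\<lambda>n. F n z) \<longlonglongrightarrow> g z"
      "\<And>z. z \<in> S \<Longrightarrow> (g has_derivative (\<lambda>v. \<Sum>k\<in>UNIV. v $ k * P k z)) (at z within S)" by blast
    \<comment> \<open>The theorem on sequences of derivatives only yields some limit function;
      uniqueness of pointwise limits identifies it with G on S.\<close>
    have "g z = G z" if "z \<in> S" for z using g(1)[OF that] G LIMSEQ_unique by blast
    then show ?thesis
      using has_derivative_transform_within_open[of g _ x UNIV S G] g(2)[OF x(1)] x at_within_open[OF x(1,2)]
      by simp
  qed
  then show ?thesis by (rule entireI)
qed

text \<open>The Taylor remainder after the linear term is at most 2 B (|h|/2)^2 = B |h|^2 / 2, and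
  division by h leaves an error that is linear in |h|. The margin 2 in the radius is that of the
  circle in the remainder estimate.\<close>

lemma difference_quotient_bound:
  assumes g: "g \<in> entire" and B: "\<And>w. norm w \<le> norm z + 2 \<Longrightarrow> norm (g w) \<le> B"
    and h: "norm h \<le> 1" "h \<noteq> 0"
  shows "norm ((g (z + h *s axis k 1) - g z) / h - partial k g z) \<le> B * norm h"
proof -
  let ?\<phi> = "\<lambda>t. g (z + t *s axis k 1)"
  have "norm (?\<phi> h - (\<Sum>m<2. (deriv ^^ m) ?\<phi> 0 / fact m * h ^ m)) \<le> 2 * B * (norm h / 2) ^ 2"
  proof (rule taylor_remainder_bound)
    fix t :: complex assume "norm t = 2"
    then have "norm (z + t *s axis k 1) \<le> norm z + 2"
      using norm_triangle_ineq[of z "t *s axis k 1"] by (simp add: norm_scalar_mult_vec norm_axis)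
    then show "norm (?\<phi> t) \<le> B" by (rule B)
  qed (use g h in \<open>auto intro: entire_holomorphic_line\<close>)
  moreover have "deriv ?\<phi> 0 = partial k g z" by (simp add: partial_def flip: axis_eq_scalar_mult)
  ultimately have *: "norm (?\<phi> h - g z - partial k g z * h) \<le> B * (norm h)\<^sup>2 / 2"
    by (simp add: numeral_2_eq_2 algebra_simps)
  have B0: "B \<ge> 0" using B[of z] norm_ge_zero[of "g z"] by linarith
  have "(?\<phi> h - g z) / h - partial k g z = (?\<phi> h - g z - partial k g z * h) / h"
    using h by (simp add: field_simps)
  then have "norm ((?\<phi> h - g z) / h - partial k g z) \<le> B * (norm h)\<^sup>2 / 2 / norm h"
    using divide_right_mono[OF *, of "norm h"] by (simp only: norm_divide) simp
  also have "\<dots> \<le> B * norm h"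
    using h B0 by (simp add: power2_eq_square)
  finally show ?thesis .
qed

text \<open>The steps 1/(n+1) form a sequence tending to 0 and are never 0. As a combination of
  translates of g, the quotient inherits entireness from g without any knowledge of second
  derivatives.\<close>

definition diff_quot :: "'d \<Rightarrow> nat \<Rightarrow> (complex ^ 'd \<Rightarrow> complex) \<Rightarrow> complex ^ 'd \<Rightarrow> complex" where
  "diff_quot k n g = (\<lambda>z. (g (z + (1 / of_nat (Suc n)) *s axis k 1) - g z) / (1 / of_nat (Suc n)))"

lemma diff_quot_eq:
  "diff_quot k n g = fscale (of_nat (Suc n)) ((\<lambda>z. g (z + (1 / of_nat (Suc n)) *s axis k 1)) - g)"
  by (auto simp: diff_quot_def fscale_def field_simps fun_eq_iff)

lemma entire_diff_quot:
  assumes "g \<in> entire"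
  shows "diff_quot k n g \<in> entire" "partial j (diff_quot k n g) = diff_quot k n (partial j g)"
  unfolding diff_quot_eq using assms
  by (simp_all add: entire_fscale entire_diff entire_translate)

lemma diff_quot_uniform_limit:
  assumes g: "g \<in> entire" and e: "e > 0"
  shows "\<exists>N. \<forall>n\<ge>N. \<forall>z. norm z \<le> R \<longrightarrow> norm (diff_quot k n g z - partial k g z) < e"
proof -
  obtain B where B: "\<And>z. norm z \<le> R + 2 \<Longrightarrow> norm (g z) \<le> B" using entire_bounded[OF g] by blast
  have "(\<lambda>n. B * (1 / real (Suc n))) \<longlonglongrightarrow> 0"
    using tendsto_mult_right_zero[OF lim_1_over_n[THEN LIMSEQ_Suc]] by simp
  from order_tendstoD(2)[OF this e]
  obtain N where N: "\<And>n. n \<ge> N \<Longrightarrow> B * (1 / real (Suc n)) < e"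
    unfolding eventually_sequentially by blast
  have "norm (diff_quot k n g z - partial k g z) < e" if "n \<ge> N" "norm z \<le> R" for n z
  proof -
    have "norm (diff_quot k n g z - partial k g z) \<le> B * norm (1 / of_nat (Suc n) :: complex)"
      unfolding diff_quot_def
      using that by (intro difference_quotient_bound g B)
        (auto simp: norm_divide simp del: of_nat_Suc)
    also have "\<dots> < e" using N[OF that(1)] by (simp add: norm_divide del: of_nat_Suc)
    finally show ?thesis .
  qed
  then show ?thesis by blast
qed

text \<open>Difference quotients are entire and converge to the partial derivative uniformly on
  balls, so Weierstrass' theorem supplies the higher smoothness that a single complex derivative
  does not show directly.\<close>

lemma entire_partial: "g \<in> entire \<Longrightarrow> partial k g \<in> entire"
  by (rule entire_uniform_limit[of "\<lambda>n. diff_quot k n g"])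
    (auto intro: entire_diff_quot diff_quot_uniform_limit)

text \<open>Differentiation commutes with translations, hence with difference quotients.\<close>

lemma partial_commute:
  assumes g: "g \<in> entire"
  shows "partial j (partial k g) = partial k (partial j g)"
proof
  fix z
  have "(\<lambda>n. partial j (diff_quot k n g) z) \<longlonglongrightarrow> partial k (partial j g) z"
    unfolding entire_diff_quot(2)[OF g] LIMSEQ_iff
    using diff_quot_uniform_limit[OF entire_partial[OF g], of _ "norm z"] by (meson order_refl)
  \<comment> \<open>The quotients converge uniformly near z, and the Cauchy estimate applied to the
    difference transfers this to \<open>partial j\<close>.\<close>
  moreover have "(\<lambda>n. partial j (diff_quot k n g) z) \<longlonglongrightarrow> partial j (partial k g) z"
    unfolding LIMSEQ_iff
  proof (intro allI impI)
    fix e :: real assume e: "e > 0"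
    obtain N where N: "\<And>n w. n \<ge> N \<Longrightarrow> norm w \<le> norm z + 1 \<Longrightarrow>
        norm (diff_quot k n g w - partial k g w) < e / 2"
      using diff_quot_uniform_limit[OF g, of "e / 2" "norm z + 1" k] e by auto
    have "norm (partial j (diff_quot k n g) z - partial j (partial k g) z) < e" if "n \<ge> N" for n
    proof -
      have "norm (partial j (diff_quot k n g - partial k g) z) \<le> e / 2"
        using N[OF that] by (intro norm_partial_le entire_diff entire_diff_quot entire_partial g)
          (auto intro: less_imp_le)
      then show ?thesis
        using e by (simp add: entire_diff entire_diff_quot(1) entire_partial g)
    qed
    then show "\<exists>N. \<forall>n\<ge>N. norm (partial j (diff_quot k n g) z - partial j (partial k g) z) < e"
      by blast
  qed
  ultimately show "partial j (partial k g) z = partial k (partial j g) z"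
    using LIMSEQ_unique by blast
qed

section \<open>Taylor polynomials along complex lines\<close>

lemma entire_dird: "g \<in> entire \<Longrightarrow> dird v g \<in> entire"
  unfolding dird_eq_sum by (intro entire_sum entire_fscale entire_partial)

lemma entire_dird_funpow: "g \<in> entire \<Longrightarrow> (dird v ^^ m) g \<in> entire"
  by (induction m) (auto intro: entire_dird)

lemma deriv_funpow_line:
  assumes "g \<in> entire"
  shows "(deriv ^^ m) (\<lambda>t. g (w + t *s v)) = (\<lambda>t. (dird v ^^ m) g (w + t *s v))"
proof (induction m)
  case (Suc m)
  have "deriv (\<lambda>t. (dird v ^^ m) g (w + t *s v)) t = dird v ((dird v ^^ m) g) (w + t *s v)" for t
    by (intro DERIV_imp_deriv entire_has_field_derivative_line entire_dird_funpow assms)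
  then show ?case by (simp add: Suc)
qed simp

text \<open>The increment v comes before the base point, so that \<open>taylor_sum N g\<close> maps
  increments to functions of the base point. The value at w approximates g(w + v).\<close>

definition taylor_sum ::
    "nat \<Rightarrow> (complex ^ 'd \<Rightarrow> complex) \<Rightarrow> complex ^ 'd \<Rightarrow> complex ^ 'd \<Rightarrow> complex" where
  "taylor_sum N g v = (\<Sum>m<N. fscale (1 / fact m) ((dird v ^^ m) g))"

lemma entire_taylor_sum: "g \<in> entire \<Longrightarrow> taylor_sum N g v \<in> entire"
  unfolding taylor_sum_def by (intro entire_sum entire_fscale entire_dird_funpow)

text \<open>The one-variable expansion of t |-> g(w + t v) at t = 1. Uniformity in v and w jointly
  matters: later uses fix v, fix w, or put v = -w.\<close>

lemma taylor_sum_uniform_limit: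
  assumes g: "g \<in> entire" and e: "e > 0"
  shows "\<exists>N0. \<forall>N\<ge>N0. \<forall>v w. norm v \<le> R \<longrightarrow> norm w \<le> R \<longrightarrow>
    norm (taylor_sum N g v w - g (w + v)) < e"
proof -
  \<comment> \<open>On the circle |t| = 2 one has |w + t v| \<le> R + 2 R.\<close>
  obtain B where B: "\<And>z. norm z \<le> 3 * R \<Longrightarrow> norm (g z) \<le> B" using entire_bounded[OF g] by blast
  have "(\<lambda>n. 2 * B * (1 / 2) ^ n) \<longlonglongrightarrow> 0"
    by (intro tendsto_mult_right_zero LIMSEQ_power_zero) simp
  from order_tendstoD(2)[OF this e]
  obtain N0 where N0: "\<And>n. n \<ge> N0 \<Longrightarrow> 2 * B * (1 / 2) ^ n < e"
    unfolding eventually_sequentially by blast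
  have "norm (taylor_sum N g v w - g (w + v)) < e"
    if "N \<ge> N0" "norm v \<le> R" "norm w \<le> R" for N v w
  proof -
    let ?\<phi> = "\<lambda>t. g (w + t *s v)"
    have "norm (?\<phi> 1 - (\<Sum>m<N. (deriv ^^ m) ?\<phi> 0 / fact m * 1 ^ m)) \<le> 2 * B * (norm (1::complex) / 2) ^ N"
    proof (rule taylor_remainder_bound)
      fix t :: complex assume "norm t = 2"
      then have "norm (w + t *s v) \<le> 3 * R"
        using norm_triangle_ineq[of w "t *s v"] that by (simp add: norm_scalar_mult_vec)
      then show "norm (?\<phi> t) \<le> B" by (rule B)
    qed (use g in \<open>auto intro: entire_holomorphic_line\<close>)
    also have "(\<Sum>m<N. (deriv ^^ m) ?\<phi> 0 / fact m * 1 ^ m) = taylor_sum N g v w"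
      by (simp add: deriv_funpow_line[OF g] taylor_sum_def fscale_def sum_fun_apply)
    also have "2 * B * (norm (1::complex) / 2) ^ N < e" using N0[OF that(1)] by simp
    finally show ?thesis by (simp add: norm_minus_commute)
  qed
  then show ?thesis by blast
qed

section \<open>Continuous linear operators\<close>

text \<open>Membership in the closure, expressed with balls about 0. These suffice because every
  compact set lies in one; \<open>closure_of_entire_top\<close> makes the link to the
  topology.\<close>

definition approximable ::
    "(complex ^ 'd \<Rightarrow> complex) set \<Rightarrow> (complex ^ 'd \<Rightarrow> complex) \<Rightarrow> bool" where
  "approximable S g \<longleftrightarrow>
    (\<forall>R e. e > 0 \<longrightarrow> (\<exists>h\<in>S. \<forall>z. norm z \<le> R \<longrightarrow> norm (h z - g z) < e))"

lemma approximableI: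
  "(\<And>R e. e > 0 \<Longrightarrow> \<exists>h\<in>S. \<forall>z. norm z \<le> R \<longrightarrow> norm (h z - g z) < e) \<Longrightarrow> approximable S g"
  unfolding approximable_def by blast

lemma approximableD:
  assumes "approximable S g" "e > 0"
  obtains h where "h \<in> S" "\<And>z. norm z \<le> R \<Longrightarrow> norm (h z - g z) < e"
  using assms unfolding approximable_def by blast

text \<open>The distance to f attains its maximum on K, so a strict pointwise bound leaves a
  positive margin that is uniform on K. The empty K is separate because there is then no
  maximum.\<close>

lemma openin_compact_nhd:
  assumes K: "compact K" and f: "f \<in> entire"
  shows "openin entire_top (compact_nhd K e f)"
  unfolding openin_entire_top
proof (intro conjI ballI)
  show "compact_nhd K e f \<subseteq> entire" by (auto simp: compact_nhd_def)
  fix g assume g: "g \<in> compact_nhd K e f"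
  show "\<exists>L d. compact L \<and> 0 < d \<and> compact_nhd L d g \<subseteq> compact_nhd K e f"
  proof (cases "K = {}")
    case True
    then show ?thesis by (intro exI[of _ "{}"] exI[of _ 1]) (auto simp: compact_nhd_def)
  next
    case False
    have "continuous_on K (\<lambda>z. dist (g z) (f z))"
      using f g by (intro continuous_intros entire_continuous_on) (auto simp: compact_nhd_def)
    from continuous_attains_sup[OF K False this]
    obtain y where y: "y \<in> K" "\<And>z. z \<in> K \<Longrightarrow> dist (g z) (f z) \<le> dist (g y) (f y)" by blast
    have "compact_nhd K (e - dist (g y) (f y)) g \<subseteq> compact_nhd K e f"
    proof
      fix h assume h: "h \<in> compact_nhd K (e - dist (g y) (f y)) g"
      have "dist (h z) (f z) < e" if "z \<in> K" for z
        using h y(2)[OF that] that dist_triangle[of "h z" "f z" "g z"]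
        by (auto simp: compact_nhd_def)
      with h show "h \<in> compact_nhd K e f" by (auto simp: compact_nhd_def)
    qed
    moreover have "e - dist (g y) (f y) > 0" using g y(1) by (auto simp: compact_nhd_def)
    ultimately show ?thesis using K by blast
  qed
qed

lemma compact_nhd_cball:
  "compact_nhd (cball 0 R) e f = {g \<in> entire. \<forall>z. norm z \<le> R \<longrightarrow> norm (g z - f z) < e}"
  by (auto simp: compact_nhd_def dist_norm)

lemma openin_entire_topD:
  assumes "openin entire_top U" "g \<in> U"
  obtains R e where "e > 0" "compact_nhd (cball 0 R) e g \<subseteq> U"
proof -
  from assms obtain K e where K: "compact K" "e > 0" "compact_nhd K e g \<subseteq> U"
    unfolding openin_entire_top by blast
  obtain R where "K \<subseteq> cball 0 R"
    using compact_imp_bounded[OF K(1)] by (auto simp: bounded_iff subset_iff)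
  then have "compact_nhd (cball 0 R) e g \<subseteq> compact_nhd K e g" by (auto simp: compact_nhd_def)
  with K show ?thesis using that by blast
qed

lemma closure_of_entire_top:
  assumes "S \<subseteq> entire"
  shows "entire_top closure_of S = {g \<in> entire. approximable S g}"
proof (intro set_eqI iffI)
  fix g assume "g \<in> entire_top closure_of S"
  then have g: "g \<in> entire" and meets: "\<And>U. g \<in> U \<Longrightarrow> openin entire_top U \<Longrightarrow> \<exists>h\<in>S. h \<in> U"
    by (auto simp: in_closure_of)
  have "approximable S g"
  proof (rule approximableI)
    fix R e :: real assume "e > 0"
    then have "g \<in> compact_nhd (cball 0 R) e g" using g by (auto simp: compact_nhd_cball)
    from meets[OF this openin_compact_nhd[OF compact_cball g]]
    show "\<exists>h\<in>S. \<forall>z. norm z \<le> R \<longrightarrow> norm (h z - g z) < e" by (auto simp: compact_nhd_cball)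
  qed
  with g show "g \<in> {g \<in> entire. approximable S g}" by blast
next
  fix g assume g: "g \<in> {g \<in> entire. approximable S g}"
  have "\<exists>h\<in>S. h \<in> U" if U: "g \<in> U" "openin entire_top U" for U
  proof -
    obtain R e where "e > 0" "compact_nhd (cball 0 R) e g \<subseteq> U"
      using openin_entire_topD[OF U(2,1)] .
    moreover obtain h where "h \<in> S" "\<And>z. norm z \<le> R \<Longrightarrow> norm (h z - g z) < e"
      using approximableD[of S g e R] g \<open>e > 0\<close> by blast
    ultimately show ?thesis using assms by (auto simp: compact_nhd_cball)
  qed
  then show "g \<in> entire_top closure_of S" using g by (auto simp: in_closure_of)
qed

lemma continuous_map_entire_top:
  fixes T :: "(complex ^ 'd \<Rightarrow> complex) \<Rightarrow> complex ^ 'd \<Rightarrow> complex"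
  shows "continuous_map entire_top entire_top T \<longleftrightarrow> (\<forall>g\<in>entire. T g \<in> entire) \<and>
    (\<forall>g\<in>entire. \<forall>R. \<forall>e>0. \<exists>R'. \<exists>d>0. \<forall>h\<in>entire. (\<forall>z. norm z \<le> R' \<longrightarrow> norm (h z - g z) < d) \<longrightarrow>
      (\<forall>z. norm z \<le> R \<longrightarrow> norm (T h z - T g z) < e))"
  (is "?L \<longleftrightarrow> ?M \<and> ?C")
proof (intro iffI conjI)
  assume L: ?L
  then show M: ?M by (simp add: continuous_map_def Pi_iff)
  show ?C
  proof (intro ballI allI impI)
    fix g :: "complex ^ 'd \<Rightarrow> complex" and R e :: real assume g: "g \<in> entire" and e: "e > 0"
    let ?U = "{h \<in> topspace entire_top. T h \<in> compact_nhd (cball 0 R) e (T g)}"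
    have "openin entire_top ?U"
      by (rule openin_continuous_map_preimage[OF L openin_compact_nhd[OF compact_cball M[rule_format, OF g]]])
    moreover have "g \<in> ?U" using g M e by (auto simp: compact_nhd_cball)
    ultimately obtain R' d where "d > 0" "compact_nhd (cball 0 R') d g \<subseteq> ?U"
      by (rule openin_entire_topD)
    then show "\<exists>R'. \<exists>d>0. \<forall>h\<in>entire. (\<forall>z. norm z \<le> R' \<longrightarrow> norm (h z - g z) < d) \<longrightarrow>
        (\<forall>z. norm z \<le> R \<longrightarrow> norm (T h z - T g z) < e)"
      by (intro exI[of _ R'] exI[of _ d]) (auto simp: compact_nhd_cball)
  qed
next
  assume R: "?M \<and> ?C"
  then have M: "\<And>g. g \<in> entire \<Longrightarrow> T g \<in> entire" and C: ?C by simp_all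
  show ?L
    unfolding continuous_map_def
  proof (intro conjI allI impI)
    show "T \<in> topspace entire_top \<rightarrow> topspace entire_top" using M by auto
    fix U :: "(complex ^ 'd \<Rightarrow> complex) set" assume U: "openin entire_top U"
    show "openin entire_top {g \<in> topspace entire_top. T g \<in> U}"
      unfolding openin_entire_top
    proof (intro conjI ballI)
      fix g assume "g \<in> {g \<in> topspace entire_top. T g \<in> U}"
      then have g: "g \<in> entire" "T g \<in> U" by auto
      obtain R e where e: "e > 0" "compact_nhd (cball 0 R) e (T g) \<subseteq> U"
        using openin_entire_topD[OF U g(2)] .
      from C[rule_format, OF g(1) e(1), of R]
      obtain R' d where d: "d > 0" "\<forall>h\<in>entire. (\<forall>z. norm z \<le> R' \<longrightarrow> norm (h z - g z) < d) \<longrightarrow>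
          (\<forall>z. norm z \<le> R \<longrightarrow> norm (T h z - T g z) < e)"
        by (elim exE conjE)
      have "compact_nhd (cball 0 R') d g \<subseteq> {g \<in> topspace entire_top. T g \<in> U}"
        using d(2) e(2) M unfolding compact_nhd_cball by (auto simp: subset_iff)
      then show "\<exists>K e. compact K \<and> 0 < e \<and> compact_nhd K e g \<subseteq> {g \<in> topspace entire_top. T g \<in> U}"
        using d(1) compact_cball by blast
    qed auto
  qed
qed

section \<open>Linearity, continuity and preservation of closures\<close>

lemma cont_lin_operatorD:
  assumes "cont_lin_operator T"
  shows "g \<in> entire \<Longrightarrow> T g \<in> entire"
    and "f \<in> entire \<Longrightarrow> g \<in> entire \<Longrightarrow> T (f + g) = T f + T g"
    and "g \<in> entire \<Longrightarrow> T (fscale c g) = fscale c (T g)"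
  using assms unfolding cont_lin_operator_def continuous_map_entire_top by auto

lemma cont_lin_operator_diff:
  assumes "cont_lin_operator T" "f \<in> entire" "g \<in> entire"
  shows "T (f - g) = T f - T g"
proof -
  have "T (f - g) = T (f + fscale (-1) g)" by (intro arg_cong[of _ _ T]) (auto simp: fscale_def)
  also have "\<dots> = T f + fscale (-1) (T g)"
    using assms cont_lin_operatorD entire_fscale by metis
  finally show ?thesis by (auto simp: fscale_def)
qed

lemma cont_lin_operator_zero:
  assumes "cont_lin_operator T"
  shows "T 0 = 0"
  using cont_lin_operator_diff[OF assms, of 0 0] fspace.subspace_0[OF entire_subspace] by simp

lemma cont_lin_operator_sum:
  assumes T: "cont_lin_operator T" and "finite I" "\<And>i. i \<in> I \<Longrightarrow> g i \<in> entire"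
  shows "T (\<Sum>i\<in>I. g i) = (\<Sum>i\<in>I. T (g i))"
  using assms(2,3)
proof (induction I rule: finite_induct)
  case empty
  then show ?case by (simp only: sum.empty cont_lin_operator_zero[OF T])
next
  case (insert i I)
  then have "T (g i + (\<Sum>i\<in>I. g i)) = T (g i) + (\<Sum>i\<in>I. T (g i))"
    using cont_lin_operatorD(2)[OF T, of "g i" "\<Sum>i\<in>I. g i"] entire_sum[of I g] by auto
  then show ?case by (simp only: sum.insert[OF insert.hyps])
qed

lemma cont_lin_operator_cont:
  assumes "cont_lin_operator T" "g \<in> entire" "e > 0"
  obtains R' d where "d > 0" "\<forall>h\<in>entire. (\<forall>z. norm z \<le> R' \<longrightarrow> norm (h z - g z) < d) \<longrightarrow>
    (\<forall>z. norm z \<le> R \<longrightarrow> norm (T h z - T g z) < e)"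
proof -
  have "\<exists>R'. \<exists>d>0. \<forall>h\<in>entire. (\<forall>z. norm z \<le> R' \<longrightarrow> norm (h z - g z) < d) \<longrightarrow>
      (\<forall>z. norm z \<le> R \<longrightarrow> norm (T h z - T g z) < e)"
    using assms unfolding cont_lin_operator_def continuous_map_entire_top by simp
  then obtain R' d where "d > 0" and *: "\<forall>h\<in>entire. (\<forall>z. norm z \<le> R' \<longrightarrow> norm (h z - g z) < d) \<longrightarrow>
      (\<forall>z. norm z \<le> R \<longrightarrow> norm (T h z - T g z) < e)"
    by (elim exE conjE)
  then show ?thesis by (rule that)
qed

lemma cont_lin_operatorI:
  assumes "\<And>g. g \<in> entire \<Longrightarrow> T g \<in> entire"
    and "\<And>f g. f \<in> entire \<Longrightarrow> g \<in> entire \<Longrightarrow> T (f + g) = T f + T g"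
    and "\<And>c g. g \<in> entire \<Longrightarrow> T (fscale c g) = fscale c (T g)"
    and "\<And>g R e. g \<in> entire \<Longrightarrow> e > 0 \<Longrightarrow> \<exists>R'. \<exists>d>0. \<forall>h\<in>entire.
      (\<forall>z. norm z \<le> R' \<longrightarrow> norm (h z - g z) < d) \<longrightarrow> (\<forall>z. norm z \<le> R \<longrightarrow> norm (T h z - T g z) < e)"
  shows "cont_lin_operator T"
  using assms unfolding cont_lin_operator_def continuous_map_entire_top by simp

text \<open>Continuity at g alone transports approximations, so invariance of a closed span needs to
  be checked only on the span.\<close>

lemma approximable_cont_lin_operator:
  assumes T: "cont_lin_operator T" and S: "S \<subseteq> entire" "\<And>h. h \<in> S \<Longrightarrow> T h \<in> S'"
    and g: "g \<in> entire" "approximable S g"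
  shows "approximable S' (T g)"
proof (rule approximableI)
  fix R e :: real assume "e > 0"
  obtain R' d where d: "d > 0" "\<forall>h\<in>entire. (\<forall>z. norm z \<le> R' \<longrightarrow> norm (h z - g z) < d) \<longrightarrow>
      (\<forall>z. norm z \<le> R \<longrightarrow> norm (T h z - T g z) < e)"
    by (rule cont_lin_operator_cont[OF T g(1) \<open>e > 0\<close>, where R=R])
  obtain h where h: "h \<in> S" "\<And>z. norm z \<le> R' \<Longrightarrow> norm (h z - g z) < d"
    using approximableD[OF g(2) d(1), of R'] by blast
  have "norm (T h z - T g z) < e" if "norm z \<le> R" for z
    using h S(1) that by (intro d(2)[rule_format]) auto
  with S(2)[OF h(1)] show "\<exists>h\<in>S'. \<forall>z. norm z \<le> R \<longrightarrow> norm (h z - T g z) < e" by blast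
qed

section \<open>Examples and combinations of continuous operators\<close>

lemma cont_lin_operator_partial: "cont_lin_operator (partial (k :: 'd::finite))"
proof (rule cont_lin_operatorI)
  fix g :: "complex ^ 'd \<Rightarrow> complex" and R e :: real assume g: "g \<in> entire" and e: "e > 0"
  have "norm (partial k h z - partial k g z) < e"
    if h: "h \<in> entire" "\<forall>z. norm z \<le> R + 1 \<longrightarrow> norm (h z - g z) < e / 2" and z: "norm z \<le> R" for h z
  proof -
    have "norm (partial k (h - g) z) \<le> e / 2"
      using h z by (intro norm_partial_le entire_diff g) (auto intro: less_imp_le)
    then show ?thesis using e by (simp add: entire_diff h g)
  qed
  then show "\<exists>R'. \<exists>d>0. \<forall>h\<in>entire. (\<forall>z. norm z \<le> R' \<longrightarrow> norm (h z - g z) < d) \<longrightarrow>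
      (\<forall>z. norm z \<le> R \<longrightarrow> norm (partial k h z - partial k g z) < e)"
    using e by (intro exI[of _ "R + 1"] exI[of _ "e / 2"]) auto
qed (auto simp: entire_partial entire_add entire_fscale)

lemma cont_lin_operator_coord: "cont_lin_operator (\<lambda>g z. z $ (j :: 'd::finite) * g z)"
proof (rule cont_lin_operatorI)
  fix g :: "complex ^ 'd \<Rightarrow> complex" and R e :: real assume g: "g \<in> entire" and e: "e > 0"
  \<comment> \<open>On the ball |z_j| is at most |R|; the extra 1 keeps the quotient defined for R =
    0 and makes the final inequality strict.\<close>
  define d where "d = e / (\<bar>R\<bar> + 1)"
  have d: "d > 0" using e by (simp add: d_def)
  have "norm (z $ j * h z - z $ j * g z) < e" if h: "norm (h z - g z) < d" and z: "norm z \<le> R" for h z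
  proof -
    have "norm (z $ j * h z - z $ j * g z) = norm (z $ j) * norm (h z - g z)"
      by (simp flip: right_diff_distrib norm_mult)
    also have "\<dots> \<le> \<bar>R\<bar> * d"
      using h z Finite_Cartesian_Product.norm_nth_le[of z j] by (intro mult_mono) auto
    also have "\<dots> < (\<bar>R\<bar> + 1) * d" using d by simp
    also have "\<dots> = e" unfolding d_def by simp
    finally show ?thesis .
  qed
  then show "\<exists>R'. \<exists>d>0. \<forall>h\<in>entire. (\<forall>z. norm z \<le> R' \<longrightarrow> norm (h z - g z) < d) \<longrightarrow>
      (\<forall>z. norm z \<le> R \<longrightarrow> norm (z $ j * h z - z $ j * g z) < e)"
    using d by (intro exI[of _ R] exI[of _ d]) auto
qed (auto simp: entire_coord fscale_def distrib_left mult.left_commute fun_eq_iff)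

lemma cont_lin_operator_fscale:
  "cont_lin_operator (fscale c :: (complex ^ 'd \<Rightarrow> complex) \<Rightarrow> complex ^ 'd \<Rightarrow> complex)"
proof (rule cont_lin_operatorI)
  fix g :: "complex ^ 'd \<Rightarrow> complex" and R e :: real assume g: "g \<in> entire" and e: "e > 0"
  have c: "0 < norm c + 1" by (simp add: add_nonneg_pos)
  define d where "d = e / (norm c + 1)"
  have d: "d > 0" using e c by (simp add: d_def)
  have "norm (c * h z - c * g z) < e" if h: "norm (h z - g z) < d" for h z
  proof -
    have "norm (c * h z - c * g z) = norm c * norm (h z - g z)"
      by (simp flip: right_diff_distrib norm_mult)
    also have "\<dots> \<le> norm c * d" using h by (intro mult_left_mono) auto
    also have "\<dots> < (norm c + 1) * d" using d by simp
    also have "\<dots> = e" unfolding d_def using c by simp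
    finally show ?thesis .
  qed
  then show "\<exists>R'. \<exists>d>0. \<forall>h\<in>entire. (\<forall>z. norm z \<le> R' \<longrightarrow> norm (h z - g z) < d) \<longrightarrow>
      (\<forall>z. norm z \<le> R \<longrightarrow> norm (fscale c h z - fscale c g z) < e)"
    using d by (intro exI[of _ R] exI[of _ d]) (auto simp: fscale_def)
qed (auto simp: entire_fscale fspace.scale_right_distrib mult.commute)

lemma cont_lin_operator_add:
  fixes S T :: "(complex ^ 'd \<Rightarrow> complex) \<Rightarrow> complex ^ 'd \<Rightarrow> complex"
  assumes S: "cont_lin_operator S" and T: "cont_lin_operator T"
  shows "cont_lin_operator (\<lambda>g. S g + T g)"
proof (rule cont_lin_operatorI)
  fix g :: "complex ^ 'd \<Rightarrow> complex" and R e :: real assume g: "g \<in> entire" and e: "e > 0"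
  from e have e2: "e / 2 > 0" by simp
  obtain R1 d1 where 1: "d1 > 0" "\<forall>h\<in>entire. (\<forall>z. norm z \<le> R1 \<longrightarrow> norm (h z - g z) < d1) \<longrightarrow>
      (\<forall>z. norm z \<le> R \<longrightarrow> norm (S h z - S g z) < e / 2)" by (rule cont_lin_operator_cont[OF S g e2, where R=R])
  obtain R2 d2 where 2: "d2 > 0" "\<forall>h\<in>entire. (\<forall>z. norm z \<le> R2 \<longrightarrow> norm (h z - g z) < d2) \<longrightarrow>
      (\<forall>z. norm z \<le> R \<longrightarrow> norm (T h z - T g z) < e / 2)" by (rule cont_lin_operator_cont[OF T g e2, where R=R])
  have "norm ((S h + T h) z - (S g + T g) z) < e"
    if h: "h \<in> entire" "\<forall>z. norm z \<le> max R1 R2 \<longrightarrow> norm (h z - g z) < min d1 d2" and z: "norm z \<le> R" for h z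
  proof -
    have "norm (S h z - S g z) < e / 2" using h z by (intro 1(2)[rule_format]) auto
    moreover have "norm (T h z - T g z) < e / 2" using h z by (intro 2(2)[rule_format]) auto
    ultimately show ?thesis
      using norm_diff_triangle_ineq[of "S h z" "T h z" "S g z" "T g z"] by simp
  qed
  then show "\<exists>R'. \<exists>d>0. \<forall>h\<in>entire. (\<forall>z. norm z \<le> R' \<longrightarrow> norm (h z - g z) < d) \<longrightarrow>
      (\<forall>z. norm z \<le> R \<longrightarrow> norm ((S h + T h) z - (S g + T g) z) < e)"
    using 1(1) 2(1) by (intro exI[of _ "max R1 R2"] exI[of _ "min d1 d2"]) simp
qed (simp_all add: entire_add cont_lin_operatorD[OF S] cont_lin_operatorD[OF T]
    fspace.scale_right_distrib)

lemma cont_lin_operator_compose: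
  assumes "cont_lin_operator S" "cont_lin_operator T"
  shows "cont_lin_operator (\<lambda>g. S (T g))"
  unfolding cont_lin_operator_def
proof (intro conjI ballI allI)
  show "continuous_map entire_top entire_top (\<lambda>g. S (T g))"
    using assms continuous_map_compose[of entire_top entire_top T entire_top S]
    unfolding cont_lin_operator_def by (simp add: o_def)
qed (simp_all add: cont_lin_operatorD[OF assms(1)] cont_lin_operatorD[OF assms(2)])

lemma subspace_closure:
  assumes S: "S \<subseteq> entire" "fspace.subspace S"
  shows "fspace.subspace {g \<in> entire. approximable S g}"
  unfolding fspace.subspace_def
proof (intro conjI ballI allI)
  show "0 \<in> {g \<in> entire. approximable S g}"
    using fspace.subspace_0[OF entire_subspace] fspace.subspace_0[OF S(2)]
    by (auto intro!: approximableI bexI[of _ 0])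
  show "fscale c g \<in> {g \<in> entire. approximable S g}" if "g \<in> {g \<in> entire. approximable S g}" for c g
  proof -
    have "approximable S (fscale c g)"
      by (rule approximable_cont_lin_operator[OF cont_lin_operator_fscale S(1)])
        (use that fspace.subspace_scale[OF S(2)] in auto)
    with that show ?thesis by (simp add: entire_fscale)
  qed
  fix f g assume fg: "f \<in> {g \<in> entire. approximable S g}" "g \<in> {g \<in> entire. approximable S g}"
  have "approximable S (f + g)"
  proof (rule approximableI)
    fix R e :: real assume "e > 0"
    then have e: "e / 2 > 0" by simp
    obtain f' where f': "f' \<in> S" "\<And>z. norm z \<le> R \<Longrightarrow> norm (f' z - f z) < e / 2"
      using approximableD[of S f "e / 2" R] fg(1) e by blast
    obtain g' where g': "g' \<in> S" "\<And>z. norm z \<le> R \<Longrightarrow> norm (g' z - g z) < e / 2"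
      using approximableD[of S g "e / 2" R] fg(2) e by blast
    have "norm ((f' + g') z - (f + g) z) < e" if "norm z \<le> R" for z
      using norm_diff_triangle_ineq[of "f' z" "g' z" "f z" "g z"] f'(2)[OF that] g'(2)[OF that] by simp
    with f' g' show "\<exists>h\<in>S. \<forall>z. norm z \<le> R \<longrightarrow> norm (h z - (f + g) z) < e"
      using fspace.subspace_add[OF S(2)] by blast
  qed
  then show "f + g \<in> {g \<in> entire. approximable S g}" using fg entire_add by auto
qed

section \<open>Invariant subspaces\<close>

text \<open>Polynomials in the coordinates. Generation by coordinate multiplication lets invariance
  of a subspace under the coordinates pass to all polynomials by induction.\<close>

inductive_set poly_fun :: "(complex ^ 'd \<Rightarrow> complex) set" where
  const: "(\<lambda>_. c) \<in> poly_fun"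
| coord: "p \<in> poly_fun \<Longrightarrow> (\<lambda>z. z $ j * p z) \<in> poly_fun"
| add: "p \<in> poly_fun \<Longrightarrow> q \<in> poly_fun \<Longrightarrow> p + q \<in> poly_fun"

lemma poly_fun_fscale: "p \<in> poly_fun \<Longrightarrow> fscale c p \<in> poly_fun"
proof (induction rule: poly_fun.induct)
  case (coord p j)
  have "fscale c (\<lambda>z. z $ j * p z) = (\<lambda>z. z $ j * fscale c p z)"
    by (auto simp: fscale_def)
  then show ?case using poly_fun.coord[OF coord.IH] by simp
next
  case (add p q)
  then show ?case by (simp only: fspace.scale_right_distrib poly_fun.add)
qed (simp add: fscale_def poly_fun.const)

lemma poly_fun_subset_entire: "poly_fun \<subseteq> entire"
proof
  show "p \<in> entire" if "p \<in> poly_fun" for p :: "complex ^ 'd \<Rightarrow> complex"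
    using that by induction (intro entire_const entire_coord(1) entire_add(1); assumption)+
qed

text \<open>The algebraic tensor product of the polynomials in v with V, as finite sums of p(v)
  g(w). A fixed v gives an element of V, a fixed w gives a polynomial in v, and both readings are
  used.\<close>

inductive_set separable ::
    "(complex ^ 'd \<Rightarrow> complex) set \<Rightarrow> (complex ^ 'd \<Rightarrow> complex ^ 'd \<Rightarrow> complex) set"
  for V where
  mult: "p \<in> poly_fun \<Longrightarrow> g \<in> V \<Longrightarrow> (\<lambda>v. fscale (p v) g) \<in> separable V"
| add: "F \<in> separable V \<Longrightarrow> G \<in> separable V \<Longrightarrow> (\<lambda>v. F v + G v) \<in> separable V"

lemma separable_subspace:
  assumes "fspace.subspace V" "G \<in> separable V"
  shows "G v \<in> V"
  using assms(2,1) by induction (auto intro: fspace.subspace_scale fspace.subspace_add)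

lemma separable_poly_fun:
  assumes "G \<in> separable V"
  shows "(\<lambda>v. G v w) \<in> poly_fun"
  using assms
proof induction
  case (mult p g)
  have "(\<lambda>v. fscale (p v) g w) = fscale (g w) p" by (auto simp: fscale_def)
  with mult show ?case by (simp add: poly_fun_fscale)
next
  case (add F G)
  have "(\<lambda>v. (F v + G v) w) = (\<lambda>v. F v w) + (\<lambda>v. G v w)" by auto
  with add.IH show ?case by (simp only: poly_fun.add)
qed

lemma separable_sum:
  assumes V: "fspace.subspace V" and "finite I" "\<And>i. i \<in> I \<Longrightarrow> F i \<in> separable V"
  shows "(\<lambda>v. \<Sum>i\<in>I. F i v) \<in> separable V"
  using assms(2,3)
proof (induction I rule: finite_induct)
  case empty
  have "(\<lambda>v. fscale 0 0) \<in> separable V"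
    by (rule separable.mult[OF poly_fun.const fspace.subspace_0[OF V]])
  then show ?case by (simp only: sum.empty fspace.scale_zero_left)
next
  case (insert i I)
  have "(\<lambda>v. F i v + (\<Sum>i\<in>I. F i v)) \<in> separable V"
    using insert.IH insert.prems by (intro separable.add) auto
  then show ?case by (simp only: sum.insert[OF insert.hyps])
qed

lemma separable_fscale:
  assumes "fspace.subspace V" "G \<in> separable V"
  shows "(\<lambda>v. fscale c (G v)) \<in> separable V"
  using assms(2)
proof induction
  case (mult p g)
  have "(\<lambda>v. fscale c (fscale (p v) g)) = (\<lambda>v. fscale (p v) (fscale c g))"
    by (simp only: fspace.scale_left_commute)
  then show ?case
    using separable.mult[OF mult(1) fspace.subspace_scale[OF assms(1) mult(2)]] by simp
next
  case (add F G)
  then show ?case by (simp only: fspace.scale_right_distrib separable.add)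
qed

text \<open>Invariance under \<open>partial k\<close> keeps every Taylor coefficient of an element
  of V, as a function of the base point, inside V.\<close>

locale diff_subspace =
  fixes V :: "(complex ^ 'd \<Rightarrow> complex) set"
  assumes entire: "V \<subseteq> entire"
    and subspace: "fspace.subspace V"
    and partial: "g \<in> V \<Longrightarrow> partial k g \<in> V"
begin

text \<open>Differentiation acts only on the base point: the factor \<open>v $ k\<close> is absorbed
  by the polynomial and \<open>partial k\<close> by the element of V.\<close>

lemma separable_dird:
  assumes "G \<in> separable V"
  shows "(\<lambda>v. dird v (G v)) \<in> separable V"
  using assms
proof induction
  case (mult p g)
  then have g: "g \<in> entire" using entire by blast
  have "(\<lambda>v. dird v (fscale (p v) g)) = (\<lambda>v. \<Sum>k\<in>UNIV. fscale (v $ k * p v) (partial k g))"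
    unfolding dird_eq_sum entire_fscale(2)[OF g] by simp
  moreover have "(\<lambda>v. \<Sum>k\<in>UNIV. fscale (v $ k * p v) (partial k g)) \<in> separable V"
    using mult by (intro separable_sum subspace separable.mult poly_fun.coord partial) auto
  ultimately show ?case by simp
next
  case (add F G)
  have "dird v (F v + G v) = dird v (F v) + dird v (G v)" for v
  proof -
    have "F v \<in> entire" "G v \<in> entire"
      using separable_subspace[OF subspace] add.hyps entire by blast+
    then show ?thesis
      by (simp only: dird_eq_sum entire_add fspace.scale_right_distrib sum.distrib)
  qed
  with add.IH show ?case by (simp only: separable.add)
qed

lemma separable_taylor_sum:
  assumes "g \<in> V"
  shows "taylor_sum N g \<in> separable V"
proof -
  have "(\<lambda>v. (dird v ^^ m) g) \<in> separable V" for m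
  proof (induction m)
    case 0
    have "(\<lambda>v. fscale 1 g) \<in> separable V" by (rule separable.mult[OF poly_fun.const assms])
    then show ?case by simp
  next
    case (Suc m)
    from separable_dird[OF this] show ?case by simp
  qed
  then have "(\<lambda>v. \<Sum>m<N. fscale (1 / fact m) ((dird v ^^ m) g)) \<in> separable V"
    by (intro separable_sum separable_fscale subspace) auto
  then show ?thesis by (simp only: taylor_sum_def[abs_def] eta_contract_eq)
qed

end

lemma diff_subspace_entire: "diff_subspace entire"
  by unfold_locales (auto simp: entire_subspace entire_partial)

text \<open>Taylor expansion about 0, read as a function of the increment: this is the separable
  form for V = \<open>entire\<close> at base point 0.\<close>

lemma approximable_poly_fun:
  assumes "g \<in> entire"
  shows "approximable poly_fun g"
proof (rule approximableI)
  fix R e :: real assume "e > 0"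
  \<comment> \<open>The bound has to admit the base point 0 even when R is negative.\<close>
  from taylor_sum_uniform_limit[OF assms this, of "max R 0"]
  obtain N where N: "\<forall>v w. norm v \<le> max R 0 \<longrightarrow> norm w \<le> max R 0 \<longrightarrow>
      norm (taylor_sum N g v w - g (w + v)) < e" by blast
  have "norm (taylor_sum N g z 0 - g z) < e" if "norm z \<le> R" for z
    using N[rule_format, of z 0] that by simp
  moreover have "(\<lambda>z. taylor_sum N g z 0) \<in> poly_fun"
    by (rule separable_poly_fun[OF diff_subspace.separable_taylor_sum[OF diff_subspace_entire assms]])
  ultimately show "\<exists>h\<in>poly_fun. \<forall>z. norm z \<le> R \<longrightarrow> norm (h z - g z) < e" by (intro bexI) auto
qed

text \<open>Only commutation with the partial derivatives is assumed; the translation invariance of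
  the name is derived in \<open>L_translate\<close>.\<close>

locale translation_invariant_operator =
  fixes L :: "(complex ^ 'd \<Rightarrow> complex) \<Rightarrow> complex ^ 'd \<Rightarrow> complex"
  assumes cont_lin: "cont_lin_operator L"
    and commutes: "g \<in> entire \<Longrightarrow> L (partial k g) = partial k (L g)"
begin

lemma L_dird:
  assumes "g \<in> entire"
  shows "L (dird v g) = dird v (L g)"
proof -
  have "L (dird v g) = (\<Sum>k\<in>UNIV. L (fscale (v $ k) (partial k g)))"
    unfolding dird_eq_sum
    by (intro cont_lin_operator_sum[OF cont_lin] finite entire_fscale entire_partial assms)
  also have "\<dots> = dird v (L g)"
    unfolding dird_eq_sum
    by (intro sum.cong refl) (simp only: cont_lin_operatorD(3)[OF cont_lin entire_partial[OF assms]] commutes[OF assms])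
  finally show ?thesis .
qed

lemma L_dird_funpow:
  assumes "g \<in> entire"
  shows "L ((dird v ^^ m) g) = (dird v ^^ m) (L g)"
  by (induction m) (simp_all add: L_dird entire_dird_funpow[OF assms])

lemma L_taylor_sum:
  assumes "g \<in> entire"
  shows "L (taylor_sum N g v) = taylor_sum N (L g) v"
proof -
  have "L (taylor_sum N g v) = (\<Sum>m<N. L (fscale (1 / fact m) ((dird v ^^ m) g)))"
    unfolding taylor_sum_def
    by (intro cont_lin_operator_sum[OF cont_lin] finite_lessThan entire_fscale entire_dird_funpow assms)
  also have "\<dots> = taylor_sum N (L g) v"
    unfolding taylor_sum_def
    by (intro sum.cong refl)
      (simp only: cont_lin_operatorD(3)[OF cont_lin entire_dird_funpow[OF assms]] L_dird_funpow[OF assms])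
  finally show ?thesis .
qed

text \<open>Translation by v is the exponential series of \<open>dird v\<close>. L commutes with
  each of its partial sums, and continuity of L carries this to the limit.\<close>

lemma L_translate:
  assumes g: "g \<in> entire"
  shows "L (\<lambda>z. g (z + v)) = (\<lambda>z. L g (z + v))"
proof
  fix z :: "complex ^ 'd"
  let ?R = "max (norm v) (norm z)"
  have "(\<lambda>N. taylor_sum N (L g) v z) \<longlonglongrightarrow> L g (z + v)"
    unfolding LIMSEQ_iff
  proof (intro allI impI)
    fix e :: real assume "e > 0"
    from taylor_sum_uniform_limit[OF cont_lin_operatorD(1)[OF cont_lin g] this, of ?R]
    show "\<exists>N0. \<forall>N\<ge>N0. norm (taylor_sum N (L g) v z - L g (z + v)) < e"
      by (meson max.cobounded1 max.cobounded2)
  qed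
  moreover have "(\<lambda>N. L (taylor_sum N g v) z) \<longlonglongrightarrow> L (\<lambda>z. g (z + v)) z"
    unfolding LIMSEQ_iff
  proof (intro allI impI)
    fix e :: real assume "e > 0"
    obtain R' d where d: "d > 0" "\<forall>h\<in>entire. (\<forall>y. norm y \<le> R' \<longrightarrow> norm (h y - g (y + v)) < d) \<longrightarrow>
        (\<forall>y. norm y \<le> norm z \<longrightarrow> norm (L h y - L (\<lambda>z. g (z + v)) y) < e)"
      by (rule cont_lin_operator_cont[OF cont_lin entire_translate(1)[OF g] \<open>e > 0\<close>, where R="norm z"])
    \<comment> \<open>Closeness is required on the ball of radius R' given by the continuity of L,
      hence a bound covering both v and R'.\<close>
    obtain N0 where N0: "\<forall>N\<ge>N0. \<forall>u w. norm u \<le> max (norm v) R' \<longrightarrow> norm w \<le> max (norm v) R' \<longrightarrow>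
        norm (taylor_sum N g u w - g (w + u)) < d"
      using taylor_sum_uniform_limit[OF g d(1)] by blast
    have "norm (L (taylor_sum N g v) z - L (\<lambda>z. g (z + v)) z) < e" if "N \<ge> N0" for N
      using that N0 by (intro d(2)[rule_format] entire_taylor_sum g) auto
    then show "\<exists>N0. \<forall>N\<ge>N0. norm (L (taylor_sum N g v) z - L (\<lambda>z. g (z + v)) z) < e" by blast
  qed
  ultimately show "L (\<lambda>z. g (z + v)) z = L g (z + v)"
    unfolding L_taylor_sum[OF g] using LIMSEQ_unique by blast
qed

text \<open>The functional h |-> L h 0, applied in v, turns each polynomial factor into the scalar
  \<open>L p 0\<close> and leaves the factor from V untouched.\<close>

lemma L_separable:
  assumes V: "fspace.subspace V" and "G \<in> separable V"
  shows "(\<lambda>w. L (\<lambda>v. G v w) 0) \<in> V"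
  using assms(2)
proof induction
  case (mult p g)
  have "L (\<lambda>v. fscale (p v) g w) 0 = fscale (L p 0) g w" for w
  proof -
    have "(\<lambda>v. fscale (p v) g w) = fscale (g w) p" by (auto simp: fscale_def)
    then show ?thesis
      using cont_lin_operatorD(3)[OF cont_lin, of p "g w"] mult(1) poly_fun_subset_entire
      by (auto simp: fscale_def)
  qed
  then show ?case using fspace.subspace_scale[OF V mult(2)] by (simp add: eta_contract_eq)
next
  case (add F G)
  have "L (\<lambda>v. (F v + G v) w) 0 = L (\<lambda>v. F v w) 0 + L (\<lambda>v. G v w) 0" for w
  proof -
    have "(\<lambda>v. (F v + G v) w) = (\<lambda>v. F v w) + (\<lambda>v. G v w)" by auto
    moreover have "(\<lambda>v. F v w) \<in> entire" "(\<lambda>v. G v w) \<in> entire"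
      using separable_poly_fun add.hyps poly_fun_subset_entire by blast+
    ultimately show ?thesis using cont_lin_operatorD(2)[OF cont_lin] by simp
  qed
  then show ?case using fspace.subspace_add[OF V add.IH] by (simp add: plus_fun_def)
qed

lemma L_closed_subspace:
  assumes V: "diff_subspace V" and closed: "\<And>h. h \<in> entire \<Longrightarrow> approximable V h \<Longrightarrow> h \<in> V"
    and g: "g \<in> V"
  shows "L g \<in> V"
proof (rule closed)
  interpret diff_subspace V by fact
  have ge: "g \<in> entire" using g entire by blast
  then show "L g \<in> entire" by (rule cont_lin_operatorD(1)[OF cont_lin])
  show "approximable V (L g)"
  proof (rule approximableI)
    fix R e :: real assume e: "e > 0"
    have zero: "0 \<in> entire" by (rule fspace.subspace_0[OF entire_subspace])
    \<comment> \<open>Continuity is taken at 0 rather than at the translates of g, so that R' and d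
      do not depend on w. The output radius is 0 because only the value at the origin
      enters.\<close>
    obtain R' d where d: "d > 0" "\<forall>h\<in>entire. (\<forall>y. norm y \<le> R' \<longrightarrow> norm (h y - 0 y) < d) \<longrightarrow>
        (\<forall>y::complex^'d. norm y \<le> 0 \<longrightarrow> norm (L h y - L 0 y) < e)"
      by (rule cont_lin_operator_cont[OF cont_lin zero e, where R=0])
    obtain N where N: "\<forall>v w. norm v \<le> max R R' \<longrightarrow> norm w \<le> max R R' \<longrightarrow>
        norm (taylor_sum N g v w - g (w + v)) < d"
      using taylor_sum_uniform_limit[OF ge d(1), of "max R R'"] by blast
    have sep: "taylor_sum N g \<in> separable V" by (rule separable_taylor_sum[OF g])
    have "norm (L (\<lambda>v. taylor_sum N g v w) 0 - L g w) < e" if w: "norm w \<le> R" for w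
    proof -
      let ?A = "\<lambda>v. taylor_sum N g v w" and ?B = "\<lambda>v. g (v + w)"
      have A: "?A \<in> entire" using separable_poly_fun[OF sep] poly_fun_subset_entire by blast
      have B: "?B \<in> entire" by (rule entire_translate(1)[OF ge])
      have "norm ((?A - ?B) y - 0 y) < d" if "norm y \<le> R'" for y
        using N[rule_format, of y w] that w by (simp add: add.commute)
      then have "norm (L (?A - ?B) 0 - L 0 0) < e"
        by (intro d(2)[rule_format] entire_diff A B) auto
      moreover have "L (?A - ?B) 0 = L ?A 0 - L g w"
        unfolding cont_lin_operator_diff[OF cont_lin A B] L_translate[OF ge] by simp
      ultimately show ?thesis by (simp add: cont_lin_operator_zero[OF cont_lin])
    qed
    with L_separable[OF subspace sep]
    show "\<exists>h\<in>V. \<forall>z. norm z \<le> R \<longrightarrow> norm (h z - L g z) < e" by (intro bexI) auto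
  qed
qed

end

section \<open>Closed submodules over the Weyl algebra\<close>

lemma poly_fun_reflect_mult:
  assumes coord: "\<And>j g. g \<in> V \<Longrightarrow> (\<lambda>z. z $ j * g z) \<in> V" and V: "fspace.subspace V"
    and "p \<in> poly_fun" "g \<in> V"
  shows "(\<lambda>z. p (- z) * g z) \<in> V"
  using assms(3,4)
proof (induction arbitrary: g)
  case (const c)
  then show ?case using fspace.subspace_scale[OF V, of g c] by (simp add: fscale_def)
next
  case (coord p j)
  have "(\<lambda>z. (- z) $ j * p (- z) * g z) = fscale (-1) (\<lambda>z. z $ j * (p (- z) * g z))"
    by (auto simp: fscale_def)
  then show ?case
    using fspace.subspace_scale[OF V assms(1)[OF coord.IH[OF coord.prems]], of "-1" j] by simp
next
  case (add p q)
  have "(\<lambda>z. (p + q) (- z) * g z) = (\<lambda>z. p (- z) * g z) + (\<lambda>z. q (- z) * g z)"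
    by (auto simp: distrib_right)
  then show ?case using fspace.subspace_add[OF V add.IH[OF add.prems]] by simp
qed

text \<open>On the antidiagonal v = -z the polynomial factor becomes a multiplier in the base
  variable; this is where invariance under the coordinates is used.\<close>

lemma separable_reflect:
  assumes coord: "\<And>j g. g \<in> V \<Longrightarrow> (\<lambda>z. z $ j * g z) \<in> V" and V: "fspace.subspace V"
    and "G \<in> separable V"
  shows "(\<lambda>z. G (- z) z) \<in> V"
  using assms(3)
proof induction
  case (mult p g)
  have "(\<lambda>z. p (- z) * g z) \<in> V"
    by (rule poly_fun_reflect_mult[OF _ V mult.hyps]) (rule coord)
  then show ?case by (simp add: fscale_def)
next
  case (add F G)
  have "(\<lambda>z. (F (- z) + G (- z)) z) = (\<lambda>z. F (- z) z) + (\<lambda>z. G (- z) z)" by auto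
  then show ?case using fspace.subspace_add[OF V add.IH] by simp
qed

text \<open>Topological irreducibility of the entire functions over the Weyl algebra. For a nonzero
  polynomial enough derivatives would leave a nonzero constant; for an entire function the constant
  is reached in the limit, as the sum of (-z)^n D^n g(z) / n! equals g(0).\<close>

lemma closed_weyl_submodule_eq_entire:
  assumes V: "diff_subspace V" and closed: "\<And>h. h \<in> entire \<Longrightarrow> approximable V h \<Longrightarrow> h \<in> V"
    and coord: "\<And>j g. g \<in> V \<Longrightarrow> (\<lambda>z. z $ j * g z) \<in> V"
    and f: "f \<in> V" "f \<noteq> 0"
  shows "V = entire"
proof -
  interpret diff_subspace V by fact
  have const: "(\<lambda>_. g 0) \<in> V" if g: "g \<in> V" for g
  proof (rule closed[OF entire_const approximableI])
    fix R e :: real assume e: "e > 0"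
    have ge: "g \<in> entire" using g entire by blast
    obtain N where N: "\<forall>v w. norm v \<le> R \<longrightarrow> norm w \<le> R \<longrightarrow>
        norm (taylor_sum N g v w - g (w + v)) < e"
      using taylor_sum_uniform_limit[OF ge e, of R] by blast
    have "norm (taylor_sum N g (- z) z - g 0) < e" if "norm z \<le> R" for z
      using N[rule_format, of "- z" z] that by simp
    moreover have "(\<lambda>z. taylor_sum N g (- z) z) \<in> V"
      by (rule separable_reflect[OF _ subspace separable_taylor_sum[OF g]]) (rule coord)
    ultimately show "\<exists>h\<in>V. \<forall>z. norm z \<le> R \<longrightarrow> norm (h z - g 0) < e" by (intro bexI) auto
  qed
  \<comment> \<open>Every Taylor sum of f lies in V. If all elements of V vanished at 0, these sums
    would vanish at base point 0, and f with them.\<close>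
  have "\<exists>g\<in>V. g 0 \<noteq> 0"
  proof (rule ccontr)
    assume "\<not> (\<exists>g\<in>V. g 0 \<noteq> 0)"
    then have zero: "\<And>g. g \<in> V \<Longrightarrow> g 0 = 0" by blast
    have fe: "f \<in> entire" using f entire by blast
    have "f z = 0" for z
    proof (rule ccontr)
      assume "f z \<noteq> 0"
      then obtain N where "\<forall>v w. norm v \<le> norm z \<longrightarrow> norm w \<le> norm z \<longrightarrow>
          norm (taylor_sum N f v w - f (w + v)) < norm (f z)"
        using taylor_sum_uniform_limit[OF fe, of "norm (f z)" "norm z"] by auto
      from this[rule_format, of z 0] have "norm (taylor_sum N f z 0 - f z) < norm (f z)" by simp
      moreover have "taylor_sum N f z 0 = 0"
        by (rule zero[OF separable_subspace[OF subspace separable_taylor_sum[OF f(1)]]])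
      ultimately show False by simp
    qed
    with f(2) show False by (auto simp: fun_eq_iff)
  qed
  then obtain g where g: "g \<in> V" "g 0 \<noteq> 0" by blast
  have all_const: "(\<lambda>_. c) \<in> V" for c
    using fspace.subspace_scale[OF subspace const[OF g(1)], of "c / g 0"] g(2) by (simp add: fscale_def)
  have poly: "p \<in> V" if "p \<in> poly_fun" for p
    using that
  proof induction
    case (add p q)
    then show ?case by (intro fspace.subspace_add[OF subspace])
  qed (rule all_const, rule coord)
  show "V = entire"
  proof
    show "entire \<subseteq> V"
    proof
      fix h :: "complex ^ 'a \<Rightarrow> complex" assume h: "h \<in> entire"
      have "approximable V h"
        using approximable_poly_fun[OF h] poly unfolding approximable_def by blast
      with h show "h \<in> V" by (rule closed)
    qed
  qed (rule entire)
qed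

section \<open>The span of the mixed partial derivatives\<close>

lemma funpow_partial_entire: "g \<in> entire \<Longrightarrow> (partial i ^^ m) g \<in> entire"
  by (induction m) (simp_all add: entire_partial)

lemma partial_funpow_commute:
  assumes "g \<in> entire"
  shows "partial k ((partial i ^^ m) g) = (partial i ^^ m) (partial k g)"
proof (induction m)
  case (Suc m)
  have "partial k (partial i ((partial i ^^ m) g)) = partial i (partial k ((partial i ^^ m) g))"
    by (rule partial_commute[OF funpow_partial_entire[OF assms]])
  with Suc show ?case by simp
qed simp

lemma foldr_partial_closed:
  assumes "P f" "\<And>k g. P g \<Longrightarrow> P (partial k g)"
  shows "P (foldr (\<lambda>k. partial k ^^ n k) ks f)"
proof (induction ks)
  case (Cons k ks)
  have "P ((partial k ^^ m) g)" if "P g" for m g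
    using that by (induction m) (auto intro: assms(2))
  with Cons show ?case by simp
qed (simp add: assms(1))

text \<open>The additional derivative commutes past the other variables until it reaches the block
  of its own index; distinctness ensures that exactly one exponent is raised.\<close>

lemma partial_foldr:
  assumes f: "f \<in> entire" and "distinct ks" "k \<in> set ks"
  shows "partial k (foldr (\<lambda>i. partial i ^^ n i) ks f) =
    foldr (\<lambda>i. partial i ^^ (n(k := Suc (n k))) i) ks f"
  using assms(2,3)
proof (induction ks)
  case (Cons i ks)
  let ?h = "foldr (\<lambda>i. partial i ^^ n i) ks f"
  have h: "?h \<in> entire" by (rule foldr_partial_closed) (auto intro: f entire_partial)
  show ?case
  proof (cases "i = k")
    case True
    with Cons.prems have "foldr (\<lambda>i. partial i ^^ (n(k := Suc (n k))) i) ks f = ?h"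
      by (intro foldr_cong) auto
    with True show ?thesis by simp
  next
    case False
    with Cons show ?thesis by (simp add: partial_funpow_commute[OF h])
  qed
qed simp

lemma partial_mixed_partial:
  assumes "f \<in> entire"
  shows "partial k (mixed_partial n f) = mixed_partial (n(k := Suc (n k))) f"
  unfolding mixed_partial_def by (rule partial_foldr[OF assms]) auto

lemma partial_span_mixed_partial:
  assumes f: "f \<in> entire" and g: "g \<in> fspace.span (range (\<lambda>n. mixed_partial n f))"
  shows "partial k g \<in> fspace.span (range (\<lambda>n. mixed_partial n f))"
proof -
  let ?W = "fspace.span (range (\<lambda>n. mixed_partial n f))"
  have base: "mixed_partial n f \<in> ?W" for n by (rule fspace.span_base) simp
  have mixed_entire: "mixed_partial n f \<in> entire" for n
    unfolding mixed_partial_def by (rule foldr_partial_closed) (auto intro: f entire_partial)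
  \<comment> \<open>Membership in \<open>entire\<close> is carried along because additivity of
    \<open>partial k\<close> is available only there.\<close>
  have "g \<in> entire \<and> partial k g \<in> ?W"
    using g
  proof (induction rule: fspace.span_induct_alt)
    case base
    have "partial k 0 = 0" by (rule cont_lin_operator_zero[OF cont_lin_operator_partial])
    then show ?case
      by (simp only: fspace.span_zero fspace.subspace_0[OF entire_subspace] simp_thms)
  next
    case (step c x y)
    then obtain n where x: "x = mixed_partial n f" by blast
    have e: "fscale c x \<in> entire" unfolding x by (rule entire_fscale[OF mixed_entire])
    have "partial k (fscale c x + y) = fscale c (partial k x) + partial k y"
      using e step.IH mixed_entire[of n] by (simp only: entire_add entire_fscale x)
    moreover have "partial k x \<in> ?W" unfolding x partial_mixed_partial[OF f] by (rule base)
    ultimately show ?case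
      using step.IH e by (auto intro: entire_add(1) fspace.span_add fspace.span_scale simp del: plus_fun_apply)
  qed
  then show ?thesis ..
qed

theorem theorem2p3:
  fixes T :: "'d \<Rightarrow> (complex ^ 'd::{finite,linorder} \<Rightarrow> complex) \<Rightarrow>
             (complex ^ 'd::{finite,linorder} \<Rightarrow> complex)"
    and a :: "'d \<Rightarrow> complex"
    and f :: "complex ^ 'd::{finite,linorder} \<Rightarrow> complex"
  assumes "\<And>j. cont_lin_operator (T j)"
    and "(\<Inter>j. ker (T j)) \<noteq> {0}"
    and "\<And>j. a j \<noteq> 0"
    and "\<And>j k g. g \<in> entire \<Longrightarrow>
           commutator (T j) (partial k) g = fscale (if j = k then a j else 0) g"
    and "f \<in> (\<Inter>j. ker (T j))"
    and "f \<noteq> 0"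
  shows "complete_system (range (\<lambda>n. mixed_partial n f))"
proof -
  note T = assms(1)
  let ?M = "range (\<lambda>n. mixed_partial n f)"
  define W where "W = fspace.span ?M"
  define V where "V = {g \<in> entire. approximable W g}"
  have f: "f \<in> entire" "\<And>j. T j f = 0" using assms(5) by (auto simp: ker_def)
  have M: "?M \<subseteq> entire"
    unfolding mixed_partial_def by (auto intro!: foldr_partial_closed f entire_partial)
  then have W: "W \<subseteq> entire" unfolding W_def by (rule fspace.span_minimal[OF _ entire_subspace])
  have W_subspace: "fspace.subspace W" unfolding W_def by (rule fspace.subspace_span)
  have V_closure: "V = entire_top closure_of W" unfolding V_def closure_of_entire_top[OF W] ..
  have W_V: "W \<subseteq> V" unfolding V_closure using W by (intro closure_of_subset) simp
  have f_W: "f \<in> W"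
  proof -
    have "foldr (\<lambda>k. partial k ^^ 0) ks f = f" for ks by (induction ks) auto
    then have "mixed_partial (\<lambda>_. 0) f = f" unfolding mixed_partial_def .
    then show ?thesis unfolding W_def by (metis fspace.span_base rangeI)
  qed
  have invariant: "L g \<in> V"
    if L: "cont_lin_operator L" and "\<And>h. h \<in> W \<Longrightarrow> L h \<in> W" and "g \<in> V" for L g
    using that approximable_cont_lin_operator[OF L W, of W g] cont_lin_operatorD(1)[OF L]
    unfolding V_def by blast
  have partial_W: "partial k g \<in> W" if "g \<in> W" for k g
    using partial_span_mixed_partial[OF f(1)] that unfolding W_def by blast
  have diff_V: "diff_subspace V"
  proof
    show "V \<subseteq> entire" by (auto simp: V_def)
    show "fspace.subspace V" unfolding V_def by (rule subspace_closure[OF W W_subspace])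
    show "partial k g \<in> V" if "g \<in> V" for k g
      by (rule invariant[OF cont_lin_operator_partial partial_W that])
  qed
  have closed: "h \<in> V" if "h \<in> entire" "approximable V h" for h
  \<comment> \<open>V is itself a closure, so closing it once more adds nothing.\<close>
  proof -
    have "V \<subseteq> entire" by (auto simp: V_def)
    from closure_of_entire_top[OF this] that have "h \<in> entire_top closure_of V" by blast
    then show ?thesis unfolding V_closure by simp
  qed
  have T_partial: "T j (partial k g) = partial k (T j g) + fscale (if j = k then a j else 0) g"
    if "g \<in> entire" for j k g
    using assms(4)[OF that, of j k] unfolding commutator_def by (auto simp: fun_eq_iff algebra_simps)
  have T_W: "T j g \<in> W" if "g \<in> W" for j g
  proof -
    have mixed: "T j (mixed_partial n f) \<in> W" for n
    proof -
      \<comment> \<open>Each differentiation produces a commutator term that is a multiple of the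
        function before differentiation, so its membership in W must be part of the induction. The
        start is \<open>T j f = 0\<close>.\<close>
      have "mixed_partial n f \<in> W \<and> T j (mixed_partial n f) \<in> W"
        unfolding mixed_partial_def
      proof (rule foldr_partial_closed)
        show "f \<in> W \<and> T j f \<in> W" using f_W f(2) fspace.subspace_0[OF W_subspace] by (simp only: simp_thms)
        show "partial k g \<in> W \<and> T j (partial k g) \<in> W" if "g \<in> W \<and> T j g \<in> W" for k g
        proof
          have "g \<in> entire" using that W by blast
          from T_partial[OF this] that show "T j (partial k g) \<in> W"
            by (simp only: fspace.subspace_add[OF W_subspace] partial_W fspace.subspace_scale[OF W_subspace])
        qed (use that partial_W in blast)
      qed
      then show ?thesis ..
    qed
    \<comment> \<open>The operator is linear on \<open>entire\<close> only, hence the strengthened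
      induction.\<close>
    have "g \<in> entire \<and> T j g \<in> W"
      using that unfolding W_def
    proof (induction rule: fspace.span_induct_alt)
      case base
      then show ?case 
        by (simp only: cont_lin_operator_zero[OF T] fspace.span_zero
            fspace.subspace_0[OF entire_subspace] simp_thms)
    next
      case (step c x y)
      then obtain n where x: "x = mixed_partial n f" by blast
      have e: "x \<in> entire" using step.hyps M by blast
      have "T j (fscale c x + y) = fscale c (T j x) + T j y"
        using e step.IH by (simp only: cont_lin_operatorD(2,3)[OF T] entire_fscale(1))
      moreover have "T j x \<in> fspace.span ?M" using mixed[of n] unfolding x W_def .
      ultimately show ?case
        using step.IH entire_add(1)[OF entire_fscale(1)[OF e]]
        by (simp only: fspace.span_add fspace.span_scale)
    qed
    then show ?thesis ..
  qed
  have coord: "(\<lambda>z. z $ j * g z) \<in> V" if g: "g \<in> V" for j g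
  proof -
    \<comment> \<open>By the product rule, \<open>partial k\<close> applied to the coordinate term
      creates \<open>a j\<close> times g when j = k, which is exactly the commutator term of
      \<open>T j\<close>.\<close>
    let ?L = "\<lambda>g. T j g + fscale (a j) (\<lambda>z. z $ j * g z)"
    have ge: "g \<in> entire" using g by (simp add: V_def)
    have L: "cont_lin_operator ?L"
      by (intro cont_lin_operator_add T cont_lin_operator_compose[OF cont_lin_operator_fscale cont_lin_operator_coord])
    interpret translation_invariant_operator ?L
    proof
      show "?L (partial k g) = partial k (?L g)" if "g \<in> entire" for k g
      proof -
        have "partial k (?L g) =
            partial k (T j g) + fscale (a j) (\<lambda>z. z $ j * partial k g z + (if j = k then g z else 0))"
          using that by (simp only: entire_add(2) entire_fscale entire_coord cont_lin_operatorD(1)[OF T])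
        then show ?thesis
          unfolding T_partial[OF that] by (auto simp: fun_eq_iff fscale_def algebra_simps)
      qed
    qed (rule L)
    have "?L g \<in> V" by (rule L_closed_subspace[OF diff_V closed g])
    moreover have "T j g \<in> V" by (rule invariant[OF T T_W g])
    ultimately have "fscale (1 / a j) (?L g - T j g) \<in> V"
      using diff_subspace.subspace[OF diff_V] by (intro fspace.subspace_scale fspace.subspace_diff)
    also have "fscale (1 / a j) (?L g - T j g) = (\<lambda>z. z $ j * g z)"
      using assms(3)[of j] by (auto simp: fscale_def)
    finally show ?thesis .
  qed
  have "V = entire"
    by (rule closed_weyl_submodule_eq_entire[OF diff_V]) (use f_W W_V assms(6) closed coord in auto)
  with M show ?thesis unfolding complete_system_def V_closure W_def by blast
qed

end
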